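(* Consider the binary additive noisy multiple access channel with noiseless feedback, $Y=X_1+X_2+N$, where $X_1,X_2\in\{0,1\}$, addition is ordinary integer addition, and $N$ is uniform on $\{0,1\}$ and independent of $(X_1,X_2)$. Let $$\mathcal P=\Bigl\{(u_1,u_2,u):\ 0\le u_1\le\tfrac14,\ 0\le u_2\le\tfrac14,\ f(2u_1,2u_2)\le u\le 1-(u_1+u_2)\Bigr\}.$$ Then the capacity region of this channel is contained in $\mathcal D_1\cap\mathcal D_2$, where $$\mathcal D_1=\bigcup_{(u_1,u_2,u)\in\mathcal P}\Bigl\{(R_1,R_2):\ R_1\le\min\bigl(\tfrac12h(u),\,h(\phi(2u_1))\bigr),\ R_2\le\tfrac12h(\phi(2u_2)),\ R_1+R_2\le h\bigl(\tfrac{1-u}{2}\bigr)\Bigr\},$$ $$\mathcal D_2=\bigcup_{(u_1,u_2,u)\in\mathcal P}\Bigl\{(R_1,R_2):\ R_1\le\tfrac12h(\phi(2u_1)),\ R_2\le\min\bigl(\tfrac12h(u),\,h(\phi(2u_2))\bigr),\ R_1+R_2\le h\bigl(\tfrac{1-u}{2}\bigr)\Bigr\}.$$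
   Context: All logarithms are to base 2. $h(s)=-s\log s-(1-s)\log(1-s)$ is the binary entropy function on $[0,1]$ (with $0\log0=0$). The function $\phi:[0,1]\to[0,\frac12]$ is $\phi(s)=\frac{1-\sqrt{1-2s}}{2}$ for $0\le s\le\frac12$ and $\phi(s)=\frac{1-\sqrt{2s-1}}{2}$ for $\frac12<s\le1$. For $x,y\in[0,\frac12]$, $f(x,y)=\phi(x)+\phi(y)-2\phi(x)\phi(y)=\frac{1-\sqrt{(1-2x)(1-2y)}}{2}$. A discrete memoryless two-user multiple access channel with noiseless feedback (MAC-FB) consists of finite input alphabets $\mathcal X_1,\mathcal X_2$, a finite output alphabet $\mathcal Y$ and a transition law $p(y|x_1,x_2)$, used memorylessly. For the channel here $\mathcal X_1=\mathcal X_2=\{0,1\}$, $\mathcal Y=\{0,1,2,3\}$. An $(n,M_1,M_2,P_e)$ code consists of message sets $\mathcal M_k=\{1,\dots,M_k\}$ ($k=1,2$), encoding functions $e_{ki}:\mathcal M_k\times\mathcal Y^{i-1}\to\mathcal X_k$ for $k=1,2$ and $i=1,\dots,n$ (the $i$-th input of user $k$ is $e_{ki}(W_k,Y_1,\dots,Y_{i-1})$), and a decoder $g:\mathcal Y^n\to\mathcal M_1\times\mathcal M_2$. The messages $W_1,W_2$ are independent and uniform on $\mathcal M_1,\mathcal M_2$, and $P_e=\Pr(g(Y^n)\ne(W_1,W_2))$. A pair $(R_1,R_2)$ of nonnegative reals is achievable if for every $\epsilon>0$ and all sufficiently large $n$ there is a code with $R_1\le \log(M_1)/n$, $R_2\le\log(M_2)/n$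 and $P_e\le\epsilon$. The capacity region is the closure of the set of achievable pairs. *)

theory Defs
  imports "HOL-Probability.Probability"
begin

definition bin_entropy :: "real \<Rightarrow> real" where
  "bin_entropy s = - s * log 2 s - (1 - s) * log 2 (1 - s)"

definition phi :: "real \<Rightarrow> real" where
  "phi s = (if s \<le> 1/2 then (1 - sqrt (1 - 2 * s)) / 2 else (1 - sqrt (2 * s - 1)) / 2)"

definition f_fun :: "real \<Rightarrow> real \<Rightarrow> real" where
  "f_fun x y = phi x + phi y - 2 * phi x * phi y"

lemma f_fun_eq:
  assumes "x \<le> 1/2" "y \<le> 1/2"
  shows "f_fun x y = (1 - sqrt ((1 - 2 * x) * (1 - 2 * y))) / 2"
  using assms unfolding f_fun_def phi_def real_sqrt_mult by (simp add: field_simps)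

record ('a, 'b, 'y) mac =
  inp1 :: "'a set"
  inp2 :: "'b set"
  outp :: "'y set"
  law :: "'a \<Rightarrow> 'b \<Rightarrow> 'y pmf"

definition is_mac :: "('a, 'b, 'y) mac \<Rightarrow> bool" where
  "is_mac C \<longleftrightarrow> finite (inp1 C) \<and> inp1 C \<noteq> {} \<and> finite (inp2 C) \<and> inp2 C \<noteq> {} \<and> finite (outp C)
     \<and> (\<forall>x1\<in>inp1 C. \<forall>x2\<in>inp2 C. set_pmf (law C x1 x2) \<subseteq> outp C)"

text \<open>
  \<open>enc1 c i w ys\<close> is the \<open>i\<close>-th input of user 1 (counting from 1) for the message \<open>w\<close> after
  the feedback \<open>ys = [y\<^sub>1, \<dots>, y\<^bsub>i-1\<^esub>]\<close>; likewise \<open>enc2\<close>.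
\<close>

record ('a, 'b, 'y) fb_code =
  enc1 :: "nat \<Rightarrow> nat \<Rightarrow> 'y list \<Rightarrow> 'a"
  enc2 :: "nat \<Rightarrow> nat \<Rightarrow> 'y list \<Rightarrow> 'b"
  dec :: "'y list \<Rightarrow> nat \<times> nat"

definition is_fb_code ::
    "('a, 'b, 'y) mac \<Rightarrow> nat \<Rightarrow> nat \<Rightarrow> nat \<Rightarrow> ('a, 'b, 'y) fb_code \<Rightarrow> bool" where
  "is_fb_code C n M1 M2 c \<longleftrightarrow> 1 \<le> M1 \<and> 1 \<le> M2
     \<and> (\<forall>i\<in>{1..n}. \<forall>ys. set ys \<subseteq> outp C \<and> length ys = i - 1 \<longrightarrow>
          (\<forall>w\<in>{1..M1}. enc1 c i w ys \<in> inp1 C) \<and> (\<forall>w\<in>{1..M2}. enc2 c i w ys \<in> inp2 C))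
     \<and> (\<forall>ys. set ys \<subseteq> outp C \<and> length ys = n \<longrightarrow> dec c ys \<in> {1..M1} \<times> {1..M2})"

text \<open>The conditional law of \<open>(Y\<^sub>1, \<dots>, Y\<^sub>n)\<close> given the messages \<open>w1\<close> and \<open>w2\<close>.\<close>

primrec output_pmf ::
    "('a, 'b, 'y) mac \<Rightarrow> ('a, 'b, 'y) fb_code \<Rightarrow> nat \<Rightarrow> nat \<Rightarrow> nat \<Rightarrow> 'y list pmf" where
  "output_pmf C c w1 w2 0 = return_pmf []"
| "output_pmf C c w1 w2 (Suc n) =
     bind_pmf (output_pmf C c w1 w2 n) (\<lambda>ys.
       map_pmf (\<lambda>y. ys @ [y]) (law C (enc1 c (Suc n) w1 ys) (enc2 c (Suc n) w2 ys)))"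

definition joint_pmf ::
    "('a, 'b, 'y) mac \<Rightarrow> nat \<Rightarrow> nat \<Rightarrow> nat \<Rightarrow> ('a, 'b, 'y) fb_code \<Rightarrow> ((nat \<times> nat) \<times> 'y list) pmf" where
  "joint_pmf C n M1 M2 c =
     bind_pmf (pair_pmf (pmf_of_set {1..M1}) (pmf_of_set {1..M2})) (\<lambda>(w1, w2).
       map_pmf (\<lambda>ys. ((w1, w2), ys)) (output_pmf C c w1 w2 n))"

definition error_prob ::
    "('a, 'b, 'y) mac \<Rightarrow> nat \<Rightarrow> nat \<Rightarrow> nat \<Rightarrow> ('a, 'b, 'y) fb_code \<Rightarrow> real" where
  "error_prob C n M1 M2 c = measure_pmf.prob (joint_pmf C n M1 M2 c) {(w, ys). dec c ys \<noteq> w}"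

definition achievable :: "('a, 'b, 'y) mac \<Rightarrow> real \<times> real \<Rightarrow> bool" where
  "achievable C R \<longleftrightarrow> 0 \<le> fst R \<and> 0 \<le> snd R \<and>
     (\<forall>\<epsilon>>0. \<forall>\<^sub>F n in sequentially. \<exists>M1 M2 c. is_fb_code C n M1 M2 c
        \<and> fst R \<le> log 2 (real M1) / real n \<and> snd R \<le> log 2 (real M2) / real n
        \<and> error_prob C n M1 M2 c \<le> \<epsilon>)"

definition capacity_region :: "('a, 'b, 'y) mac \<Rightarrow> (real \<times> real) set" where
  "capacity_region C = closure {R. achievable C R}"

definition binary_additive_mac :: "(nat, nat, nat) mac" where
  "binary_additive_mac = \<lparr> inp1 = {0, 1}, inp2 = {0, 1}, outp = {0, 1, 2, 3},
     law = (\<lambda>x1 x2. map_pmf (\<lambda>z. x1 + x2 + z) (pmf_of_set {0, 1})) \<rparr>"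

lemma is_mac_binary_additive_mac: "is_mac binary_additive_mac"
  by (auto simp: is_mac_def binary_additive_mac_def)

definition P_set :: "(real \<times> real \<times> real) set" where
  "P_set = {(u1, u2, u). 0 \<le> u1 \<and> u1 \<le> 1/4 \<and> 0 \<le> u2 \<and> u2 \<le> 1/4
     \<and> f_fun (2 * u1) (2 * u2) \<le> u \<and> u \<le> 1 - (u1 + u2)}"

definition D1 :: "(real \<times> real) set" where
  "D1 = (\<Union>(u1, u2, u)\<in>P_set. {(R1, R2).
     R1 \<le> min (1/2 * bin_entropy u) (bin_entropy (phi (2 * u1)))
     \<and> R2 \<le> 1/2 * bin_entropy (phi (2 * u2))
     \<and> R1 + R2 \<le> bin_entropy ((1 - u) / 2)})"

definition D2 :: "(real \<times> real) set" where
  "D2 = (\<Union>(u1, u2, u)\<in>P_set. {(R1, R2).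
     R1 \<le> 1/2 * bin_entropy (phi (2 * u1))
     \<and> R2 \<le> min (1/2 * bin_entropy u) (bin_entropy (phi (2 * u2)))
     \<and> R1 + R2 \<le> bin_entropy ((1 - u) / 2)})"

end

theory Submission
  imports Defs
begin

text \<open>
  The converse works with likelihood ratios: if \<open>Q\<close> is a measure on messages and outputs under which
  the decoder succeeds with probability at most \<open>1 / M\<close>, then the divergence of the true law from \<open>Q\<close>
  is at least \<open>(1 - P\<^sub>e) log M - 1\<close>. Three choices of \<open>Q\<close> given by memoryless or
  posterior output kernels, together with the number of messages consistent with the inputs of user 1,
  yield the four bounds \<open>h(u)/2\<close>, \<open>E h(q)/2\<close>, \<open>h((1-u)/2)\<close> and \<open>E h(p)\<close>, where \<open>u\<close> is the
  time average of \<open>P(X\<^sub>1 \<noteq> X\<^sub>2)\<close>, and \<open>p\<close>, \<open>q\<close> are the probabilities of \<open>X\<^sub>1 = 1\<close>, \<open>X\<^sub>2 = 1\<close>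
  given \<open>T = (Y\<^sup>i\<^sup>-\<^sup>1, X\<^sub>1\<^sup>i\<^sup>-\<^sup>1)\<close>.

  Given \<open>T\<close> the two inputs are independent, so \<open>1 - 2u = E (1-2p)(1-2q)\<close>. With
  \<open>u\<^sub>1 = E p(1-p)\<close>, \<open>u\<^sub>2 = E q(1-q)\<close>, Cauchy-Schwarz gives \<open>f(2u\<^sub>1, 2u\<^sub>2) \<le> u\<close>, the inequality
  \<open>2xy \<ge> - x\<^sup>2 - y\<^sup>2\<close> gives \<open>u \<le> 1 - u\<^sub>1 - u\<^sub>2\<close>, and concavity of \<open>v \<mapsto> h(\<phi>(2v))\<close> gives
  \<open>E h(p) \<le> h(\<phi>(2u\<^sub>1))\<close> and \<open>E h(q) \<le> h(\<phi>(2u\<^sub>2))\<close>.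
\<close>

section \<open>Binary entropy\<close>

lemma bin_entropy_ln: "bin_entropy s = (- s * ln s - (1 - s) * ln (1 - s)) / ln 2"
  by (simp add: bin_entropy_def log_def field_simps)

lemma continuous_on_mult_ln:
  "continuous_on {0..} (\<lambda>x::real. x * ln x)"
proof -
  have "((\<lambda>x::real. x * ln x) \<longlongrightarrow> 0) (at_right 0)" by real_asymp
  hence "((\<lambda>x::real. x * ln x) \<longlongrightarrow> 0) (at 0 within {0..})"
    by (simp add: at_within_Ici_at_right)
  moreover have "((\<lambda>x::real. x * ln x) \<longlongrightarrow> x * ln x) (at x within {0..})" if "x > 0" for x
    using that by (intro tendsto_intros) auto
  ultimately show ?thesis unfolding continuous_on_def
    by (metis atLeast_iff less_eq_real_def mult_zero_left)
qed

lemma continuous_on_bin_entropy: "continuous_on {0..1} bin_entropy"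
  unfolding bin_entropy_ln[abs_def]
proof -
  have "continuous_on {0..1} (\<lambda>x::real. x * ln x)"
    using continuous_on_mult_ln by (rule continuous_on_subset) auto
  moreover have "continuous_on {0..1} (\<lambda>x::real. (1 - x) * ln (1 - x))"
    by (rule continuous_on_compose2[OF continuous_on_mult_ln]) (auto intro!: continuous_intros)
  ultimately have "continuous_on {0..1} (\<lambda>s. (- (s * ln s) - (1 - s) * ln (1 - s)) / ln (2::real))"
    by (intro continuous_on_divide continuous_on_diff continuous_on_minus continuous_on_const) auto
  thus "continuous_on {0..1} (\<lambda>s. (- s * ln s - (1 - s) * ln (1 - s)) / ln (2::real))"
    by simp
qed

lemma bin_entropy_sym: "bin_entropy (1 - s) = bin_entropy s"
  by (simp add: bin_entropy_def algebra_simps)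

lemma phi_small: "s \<le> 1/2 \<Longrightarrow> phi s = (1 - sqrt (1 - 2 * s)) / 2"
  by (simp add: phi_def)

text \<open>\<open>1 - 4 * p * (1 - p)\<close> is the square of \<open>1 - 2 * p\<close>, so
  \<open>phi\<close> recovers \<open>p\<close> or \<open>1 - p\<close> from twice the variance, and
  the entropy cannot tell these apart. Entropy thus becomes a function of the variance.\<close>

lemma bin_entropy_phi_var:
  assumes "0 \<le> p" "p \<le> 1"
  shows "bin_entropy (phi (2 * (p * (1 - p)))) = bin_entropy p"
proof -
  have sq: "1 - 4 * (p * (1 - p)) = (1 - 2 * p)\<^sup>2" by (simp add: power2_eq_square algebra_simps)
  have "0 \<le> (1 - 2 * p)\<^sup>2" by simp
  hence "phi (2 * (p * (1 - p))) = (1 - sqrt ((1 - 2 * p)\<^sup>2)) / 2"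
    using sq by (subst phi_small) (linarith, simp)
  also have "\<dots> = (1 - \<bar>1 - 2 * p\<bar>) / 2" by simp
  also have "\<dots> = p \<or> \<dots> = 1 - p" by (auto simp: abs_if field_simps)
  finally show ?thesis using bin_entropy_sym by metis
qed

lemma variance_range:
  fixes p :: real
  assumes "0 \<le> p" "p \<le> 1"
  shows "p * (1 - p) \<in> {0..1/4}"
proof -
  have "0 \<le> (1 - 2 * p)\<^sup>2" by simp
  hence "p * (1 - p) \<le> 1/4" by (simp add: power2_eq_square algebra_simps)
  thus ?thesis using assms by simp
qed

section \<open>Concavity of the entropy as a function of the variance\<close>

text \<open>Up to the factor \<open>1 / ln 2\<close>, the quotient at
  \<open>sqrt (1 - 4 * v)\<close> is the derivative of \<open>bin_entropy (phi (2 * v))\<close>,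
  whose concavity rests on this monotonicity.\<close>

lemma artanh_quotient_mono:
  assumes "0 < x" "x \<le> y" "y < (1::real)"
  shows "(ln (1 + x) - ln (1 - x)) / x \<le> (ln (1 + y) - ln (1 - y)) / y"
proof (rule DERIV_nonneg_imp_nondecreasing[OF assms(2)])
  fix z assume z: "x \<le> z" "z \<le> y"
  hence z01: "0 < z" "z < 1" using assms by auto
  \<comment> \<open>Numerator of the derivative of the quotient. It vanishes at 0 and its own
    derivative is \<open>4 * w^2 / (1 - w^2)^2\<close>.\<close>
  let ?A = "\<lambda>w::real. 2 * w / (1 - w\<^sup>2) - (ln (1 + w) - ln (1 - w))"
  have "?A 0 \<le> ?A z"
  proof (rule DERIV_nonneg_imp_nondecreasing[where f = ?A])
    fix w assume w: "0 \<le> w" "w \<le> z"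
    hence w1: "w < 1" "w\<^sup>2 < 1" using z01 by (auto simp: power_less_one_iff abs_square_less_1)
    have "(?A has_real_derivative (2 * (1 - w\<^sup>2) + 4 * w\<^sup>2) / (1 - w\<^sup>2)\<^sup>2 - (1/(1+w) + 1/(1-w))) (at w)"
      using w w1 by (auto intro!: derivative_eq_intros simp: field_simps power2_eq_square)
    moreover have "1/(1+w) + 1/(1-w) = 2 / (1 - w\<^sup>2)"
      using w w1 by (simp add: field_simps power2_eq_square)
    moreover have "(2 * (1 - w\<^sup>2) + 4 * w\<^sup>2) / (1 - w\<^sup>2)\<^sup>2 = 2 / (1 - w\<^sup>2) + 4 * w\<^sup>2 / (1 - w\<^sup>2)\<^sup>2"
    proof -
      have split: "(2 * d + c) / d\<^sup>2 = 2 / d + c / d\<^sup>2" if "d \<noteq> 0" for c d :: real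
        using that by (simp add: add_divide_distrib power2_eq_square)
      show ?thesis by (rule split) (use w1 in simp)
    qed
    ultimately have "(?A has_real_derivative 4 * w\<^sup>2 / (1 - w\<^sup>2)\<^sup>2) (at w)" by simp
    moreover have "0 \<le> 4 * w\<^sup>2 / (1 - w\<^sup>2)\<^sup>2" by simp
    ultimately show "\<exists>D. (?A has_real_derivative D) (at w) \<and> 0 \<le> D" by blast
  qed (use z01 in auto)
  hence A: "0 \<le> ?A z" by simp
  have "((\<lambda>w. (ln (1 + w) - ln (1 - w)) / w) has_real_derivative
     ((1/(1+z) + 1/(1-z)) * z - (ln (1 + z) - ln (1 - z))) / z\<^sup>2) (at z)"
    using z01 by (auto intro!: derivative_eq_intros simp: field_simps power2_eq_square)
  moreover have "(1/(1+z) + 1/(1-z)) * z = 2 * z / (1 - z\<^sup>2)"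
    using z01 by (simp add: field_simps power2_eq_square)
  ultimately have "((\<lambda>w. (ln (1 + w) - ln (1 - w)) / w) has_real_derivative ?A z / z\<^sup>2) (at z)"
    by simp
  moreover have "0 \<le> ?A z / z\<^sup>2" using A by simp
  ultimately show "\<exists>D. ((\<lambda>w. (ln (1 + w) - ln (1 - w)) / w) has_real_derivative D) (at z) \<and> 0 \<le> D"
    by blast
qed

text \<open>Both points are pulled slightly towards the midpoint, into the open interval; continuity
  carries the inequality to the limit.\<close>

lemma concave_on_Icc_if_Ioo:
  fixes f :: "real \<Rightarrow> real"
  assumes c: "concave_on {l<..<r} f" and cont: "continuous_on {l..r} f" and "l < r"
  shows "concave_on {l..r} f"
  unfolding concave_on_iff
proof (intro conjI ballI allI impI)
  fix x y u v :: real
  assume x: "x \<in> {l..r}" and y: "y \<in> {l..r}" and uv: "0 \<le> u" "0 \<le> v" "u + v = 1"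
  define m where "m = (l + r) / 2"
  have m: "l < m" "m < r" using \<open>l < r\<close> by (auto simp: m_def)
  define pt where "pt = (\<lambda>z n. (1 - 1 / real (n + 2)) * z + 1 / real (n + 2) * m)"
  have ptlim: "(\<lambda>n. pt z n) \<longlonglongrightarrow> z" for z unfolding pt_def by real_asymp
  have ptin: "pt z n \<in> {l<..<r}" if "z \<in> {l..r}" for z n
  proof -
    define t where "t = 1 / real (n + 2)"
    have t: "0 < t" "t < 1" by (auto simp: t_def)
    have "(1 - t) * l + t * l < (1 - t) * z + t * m" "(1 - t) * z + t * m < (1 - t) * r + t * r"
      using t m that by (auto intro!: add_le_less_mono mult_left_mono)
    thus ?thesis unfolding pt_def t_def[symmetric] by (simp add: algebra_simps)
  qed
  have flim: "(\<lambda>n. f (g n)) \<longlonglongrightarrow> f z" if "g \<longlonglongrightarrow> z" "\<And>n. g n \<in> {l<..<r}" "z \<in> {l..r}" for g z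
    using continuous_on_tendsto_compose[OF cont that(1,3)] that(2)
    by (metis (mono_tags, lifting) always_eventually atLeastAtMost_iff greaterThanLessThan_iff less_imp_le)
  have conv: "u * a + v * b \<in> S" if "a \<in> S" "b \<in> S" "convex S" for a b and S :: "real set"
    using that uv unfolding convex_def by auto
  show "u * f x + v * f y \<le> f (u *\<^sub>R x + v *\<^sub>R y)"
  proof (rule LIMSEQ_le)
    show "(\<lambda>n. u * f (pt x n) + v * f (pt y n)) \<longlonglongrightarrow> u * f x + v * f y"
      using x y ptlim ptin by (intro tendsto_intros flim) auto
    show "(\<lambda>n. f (u * pt x n + v * pt y n)) \<longlonglongrightarrow> f (u *\<^sub>R x + v *\<^sub>R y)"
      unfolding real_scaleR_def using x y ptin
      by (intro flim tendsto_intros ptlim conv) auto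
    show "\<exists>N. \<forall>n\<ge>N. u * f (pt x n) + v * f (pt y n) \<le> f (u * pt x n + v * pt y n)"
      using c uv ptin x y unfolding concave_on_iff by auto
  qed
qed auto

lemma continuous_on_phi_double: "continuous_on {0..1/4} (\<lambda>v. phi (2 * v))"
proof -
  have "continuous_on {0..1/4} (\<lambda>v::real. (1 - sqrt (1 - 2 * (2 * v))) / 2)"
    by (intro continuous_intros) auto
  thus ?thesis by (rule continuous_on_eq) (auto simp: phi_small)
qed

lemma phi_double_range: "v \<in> {0..1/4} \<Longrightarrow> phi (2 * v) \<in> {0..1/2}"
  by (auto simp: phi_small)

lemma continuous_on_entropy_phi: "continuous_on {0..1/4} (\<lambda>v. bin_entropy (phi (2 * v)))"
  by (rule continuous_on_compose2[OF continuous_on_bin_entropy continuous_on_phi_double])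
     (use phi_double_range in fastforce)

lemma concave_on_entropy_phi: "concave_on {0..1/4} (\<lambda>v. bin_entropy (phi (2 * v)))"
proof (rule concave_on_Icc_if_Ioo[OF _ continuous_on_entropy_phi])
  \<comment> \<open>Here \<open>phi (2 * v) = (1 - r v) / 2\<close>, and the chain rule gives the
    derivative \<open>D\<close>. As \<open>r\<close> decreases in \<open>v\<close>, so does
    \<open>D\<close>.\<close>
  define r where "r = (\<lambda>v::real. sqrt (1 - 4 * v))"
  define D where "D = (\<lambda>v. (ln (1 + r v) - ln (1 - r v)) / r v / ln 2)"
  have r: "0 < r v" "r v < 1" if "v \<in> {0<..<1/4}" for v
    using that by (auto simp: r_def)
  have "convex_on {0<..<1/4} (\<lambda>v. - bin_entropy (phi (2 * v)))"
  proof (rule convex_on_realI[where f' = "\<lambda>v. - D v"])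
    fix v :: real assume v: "v \<in> {0<..<1/4}"
    define H where "H = (\<lambda>p::real. (- p * ln p - (1 - p) * ln (1 - p)) / ln 2)"
    have p: "0 < (1 - r v) / 2" "(1 - r v) / 2 < 1" using r[OF v] by auto
    have dH: "(H has_real_derivative (ln (1 - p) - ln p) / ln 2) (at p)" if "0 < p" "p < 1" for p
      unfolding H_def using that
      by (intro DERIV_cdivide) (auto intro!: derivative_eq_intros)
    have dr: "((\<lambda>v. (1 - r v) / 2) has_real_derivative 1 / r v) (at v)"
      unfolding r_def using v by (auto intro!: derivative_eq_intros simp: field_simps)
    have "((\<lambda>v. H ((1 - r v) / 2)) has_real_derivative
       (ln (1 - (1 - r v) / 2) - ln ((1 - r v) / 2)) / ln 2 * (1 / r v)) (at v)"
      by (rule DERIV_chain2[OF dH[OF p] dr])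
    also have "1 - (1 - r v) / 2 = (1 + r v) / 2" by (simp add: field_simps)
    also have "(ln ((1 + r v) / 2) - ln ((1 - r v) / 2)) / ln 2 * (1 / r v) = D v"
      using r[OF v] by (simp add: D_def ln_div)
    finally have "((\<lambda>v. - H ((1 - r v) / 2)) has_real_derivative - D v) (at v)"
      by (rule DERIV_minus)
    moreover have "\<forall>\<^sub>F w in nhds v. - bin_entropy (phi (2 * w)) = - H ((1 - r w) / 2)"
      using v by (intro eventually_nhds_in_open[of "{0<..<1/4}", THEN eventually_mono])
        (auto simp: H_def bin_entropy_ln phi_small r_def)
    ultimately show "((\<lambda>v. - bin_entropy (phi (2 * v))) has_real_derivative - D v) (at v)"
      by (subst DERIV_cong_ev[OF refl _ refl]) auto
  next
    fix v w :: real assume vw: "v \<in> {0<..<1/4}" "w \<in> {0<..<1/4}" "v \<le> w"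
    hence "r w \<le> r v" by (simp add: r_def)
    hence "(ln (1 + r w) - ln (1 - r w)) / r w \<le> (ln (1 + r v) - ln (1 - r v)) / r v"
      using r[OF vw(1)] r[OF vw(2)] by (intro artanh_quotient_mono)
    hence "D w \<le> D v" unfolding D_def by (rule divide_right_mono) simp
    thus "- D v \<le> - D w" by simp
  qed (rule connected_Ioo)
  thus "concave_on {0<..<1/4} (\<lambda>v. bin_entropy (phi (2 * v)))" by (simp add: concave_on_def)
qed auto

text \<open>The choice \<open>v = u\<close> turns the cross entropy into the entropy, but it is
  excluded at \<open>u = 0\<close> and \<open>u = 1\<close>, where \<open>v\<close> tends to the
  endpoint instead. The open range of \<open>v\<close> keeps the reference laws below
  positive.\<close>

lemma le_bin_entropy_if_le_cross_entropy:
  assumes u: "0 \<le> u" "u \<le> 1"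
    and le: "\<And>v. 0 < v \<Longrightarrow> v < 1 \<Longrightarrow> x \<le> - u * log 2 v - (1 - u) * log 2 (1 - v)"
  shows "x \<le> bin_entropy u"
proof -
  have lim: "x \<le> 0" if l: "\<And>v::real. 0 < v \<Longrightarrow> v < 1 \<Longrightarrow> x \<le> - log 2 (1 - v)"
  proof (rule tendsto_lowerbound)
    have "((\<lambda>v. - log 2 (1 - v)) \<longlongrightarrow> - log 2 (1 - 0)) (at_right (0::real))"
      by (intro tendsto_intros) auto
    thus "((\<lambda>v. - log 2 (1 - v)) \<longlongrightarrow> 0) (at_right (0::real))" by simp
    show "\<forall>\<^sub>F v in at_right (0::real). x \<le> - log 2 (1 - v)"
      using eventually_at_right_real[of 0 "1::real"] by (rule eventually_mono) (use l in auto)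
  qed auto
  consider "u = 0" | "u = 1" | "0 < u" "u < 1" using u by linarith
  thus ?thesis
  proof cases
    case 1 thus ?thesis using lim le by (simp add: bin_entropy_def)
  next
    case 2
    have "x \<le> - log 2 (1 - v)" if "0 < v" "v < 1" for v
      using le[of "1 - v"] that 2 by simp
    thus ?thesis using lim 2 by (simp add: bin_entropy_def)
  next
    case 3 thus ?thesis using le[of u] by (simp add: bin_entropy_def)
  qed
qed

section \<open>Output words and kernels\<close>

lemma sum_swap_third:
  "(\<Sum>i\<in>A. \<Sum>j\<in>B. \<Sum>k\<in>C. f i j k) = (\<Sum>k\<in>C. \<Sum>i\<in>A. \<Sum>j\<in>B. f i j k)"
proof -
  have "(\<Sum>i\<in>A. \<Sum>j\<in>B. \<Sum>k\<in>C. f i j k) = (\<Sum>i\<in>A. \<Sum>k\<in>C. \<Sum>j\<in>B. f i j k)"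
    by (intro sum.cong refl sum.swap)
  also have "\<dots> = (\<Sum>k\<in>C. \<Sum>i\<in>A. \<Sum>j\<in>B. f i j k)" by (rule sum.swap)
  finally show ?thesis .
qed

lemma sum_nested_product:
  "(\<Sum>z\<in>(A \<times> B) \<times> C. f z) = (\<Sum>x\<in>A. \<Sum>y\<in>B. \<Sum>z\<in>C. f ((x, y), z))"
proof -
  have "(\<Sum>z\<in>(A \<times> B) \<times> C. f z) = (\<Sum>v\<in>A \<times> B. \<Sum>z\<in>C. f (v, z))"
    by (simp add: sum.cartesian_product)
  also have "\<dots> = (\<Sum>x\<in>A. \<Sum>y\<in>B. \<Sum>z\<in>C. f ((x, y), z))"
    using sum.cartesian_product[of "\<lambda>x y. \<Sum>z\<in>C. f ((x, y), z)" B A] by (simp add: case_prod_unfold)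
  finally show ?thesis .
qed

text \<open>Zero total weight is covered, since division by zero gives 0. Posteriors thus lie in
  [0,1] even at histories of probability zero.\<close>

lemma sum_of_bool_range:
  fixes f :: "'i \<Rightarrow> real"
  assumes "\<And>i. i \<in> A \<Longrightarrow> 0 \<le> f i"
  shows "0 \<le> (\<Sum>i\<in>A. f i * of_bool (P i)) / sum f A" "(\<Sum>i\<in>A. f i * of_bool (P i)) / sum f A \<le> 1"
proof -
  have "0 \<le> sum f A" using assms by (rule sum_nonneg)
  moreover have "(\<Sum>i\<in>A. f i * of_bool (P i)) \<le> sum f A"
    using assms by (intro sum_mono) auto
  ultimately show "(\<Sum>i\<in>A. f i * of_bool (P i)) / sum f A \<le> 1"
    by (cases "sum f A = 0") (auto simp: divide_le_eq_1 less_le)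
  show "0 \<le> (\<Sum>i\<in>A. f i * of_bool (P i)) / sum f A"
    using assms by (intro divide_nonneg_nonneg sum_nonneg) auto
qed

definition words :: "nat \<Rightarrow> nat list set" where
  "words n = {ys. set ys \<subseteq> {..<4} \<and> length ys = n}"

text \<open>The feedback histories at the times 1 to \<open>n\<close> taken together, so that one
  sum runs over time and history at once.\<close>

definition short_words :: "nat \<Rightarrow> nat list set" where
  "short_words n = {ys. set ys \<subseteq> {..<4} \<and> length ys < n}"

lemma finite_words [simp]: "finite (words n)"
  unfolding words_def by (rule finite_lists_length_eq) simp

lemma words_0 [simp]: "words 0 = {[]}"
  by (auto simp: words_def)

lemma short_words_0 [simp]: "short_words 0 = {}"
  by (auto simp: short_words_def)

lemma short_words_Suc: "short_words (Suc n) = short_words n \<union> words n"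
  by (auto simp: short_words_def words_def)

lemma short_words_words_disjoint: "short_words n \<inter> words n = {}"
  by (auto simp: short_words_def words_def)

lemma finite_short_words [simp]: "finite (short_words n)"
  by (induction n) (auto simp: short_words_Suc)

lemma sum_short_words_Suc:
  "sum G (short_words (Suc n)) = sum G (short_words n) + sum G (words n)"
  by (simp add: short_words_Suc sum.union_disjoint short_words_words_disjoint)

lemma sum_words_Suc: "sum G (words (Suc n)) = (\<Sum>ys\<in>words n. \<Sum>y<4. G (ys @ [y]))"
proof -
  have "words (Suc n) = (\<lambda>(ys, y). ys @ [y]) ` (words n \<times> {..<4})"
  proof (intro set_eqI iffI)
    fix zs assume "zs \<in> words (Suc n)"
    thus "zs \<in> (\<lambda>(ys, y). ys @ [y]) ` (words n \<times> {..<4})"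
      by (cases zs rule: rev_cases) (auto simp: words_def image_iff)
  qed (auto simp: words_def)
  moreover have inj: "inj_on (\<lambda>(ys, y). ys @ [y]) (words n \<times> {..<4})" by (auto simp: inj_on_def)
  ultimately have "sum G (words (Suc n)) = sum (G \<circ> (\<lambda>(ys, y). ys @ [y])) (words n \<times> {..<4})"
    by (simp only: sum.reindex[OF inj])
  thus ?thesis by (simp add: sum.cartesian_product case_prod_unfold o_def)
qed

section \<open>Output processes with history-dependent kernels\<close>

text \<open>The chain rule, with \<open>K ys y\<close> read as the conditional probability of the
  letter \<open>y\<close> after the history \<open>ys\<close>.\<close>

definition path_prob :: "(nat list \<Rightarrow> nat \<Rightarrow> real) \<Rightarrow> nat list \<Rightarrow> real" where
  "path_prob K ys = (\<Prod>i<length ys. K (take i ys) (ys ! i))"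

lemma path_prob_Nil [simp]: "path_prob K [] = 1"
  by (simp add: path_prob_def)

lemma path_prob_snoc [simp]: "path_prob K (ys @ [y]) = path_prob K ys * K ys y"
  by (simp add: path_prob_def nth_append)

lemma path_prob_nonneg: "(\<And>ys y. 0 \<le> K ys y) \<Longrightarrow> 0 \<le> path_prob K ys"
  by (simp add: path_prob_def prod_nonneg)

lemma sum_path_prob_words:
  assumes "\<And>ys. (\<Sum>y<4. K ys y) = 1"
  shows "sum (path_prob K) (words n) = 1"
  by (induction n) (simp_all add: sum_words_Suc sum_distrib_left[symmetric] assms)

text \<open>Dynkin's formula for the process with transition kernel \<open>K\<close>.\<close>

lemma sum_path_prob_words_increments:
  assumes "\<And>ys. (\<Sum>y<4. K ys y) = 1"
  shows "(\<Sum>ys\<in>words n. path_prob K ys * F ys) =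
    F [] + (\<Sum>ys\<in>short_words n. path_prob K ys * (\<Sum>y<4. K ys y * (F (ys @ [y]) - F ys)))"
proof (induction n)
  case (Suc n)
  have "(\<Sum>y<4. path_prob K (ys @ [y]) * F (ys @ [y])) =
     path_prob K ys * F ys + path_prob K ys * (\<Sum>y<4. K ys y * (F (ys @ [y]) - F ys))" for ys
  proof -
    have inc: "(\<Sum>y<4. K ys y * (F (ys @ [y]) - F ys)) = (\<Sum>y<4. K ys y * F (ys @ [y])) - F ys"
      by (simp add: right_diff_distrib sum_subtractf sum_distrib_right[symmetric] assms)
    have "(\<Sum>y<4. path_prob K (ys @ [y]) * F (ys @ [y])) =
        path_prob K ys * (\<Sum>y<4. K ys y * F (ys @ [y]))"
      by (simp add: sum_distrib_left mult.assoc)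
    thus ?thesis by (simp only: inc) (simp add: right_diff_distrib)
  qed
  thus ?case using Suc by (simp add: sum_words_Suc sum_short_words_Suc sum.distrib)
qed simp

section \<open>The channel law and the reference output laws\<close>

definition chan :: "bool \<Rightarrow> bool \<Rightarrow> nat \<Rightarrow> real" where
  "chan s t y = (if y = of_bool s + of_bool t \<or> y = Suc (of_bool s + of_bool t) then 1/2 else 0)"

lemma lessThan_4: "{..<4::nat} = {0, 1, 2, 3}" by auto

lemma sum_chan: "(\<Sum>y<4. chan s t y * G y) =
    (G (of_bool s + of_bool t) + G (Suc (of_bool s + of_bool t))) / 2"
  by (cases s; cases t) (simp_all add: lessThan_4 chan_def numeral_2_eq_2 numeral_3_eq_3)

lemma sum_chan_1: "(\<Sum>y<4. chan s t y) = 1"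
  using sum_chan[of s t "\<lambda>_. 1"] by simp

lemma chan_nonneg [simp]: "0 \<le> chan s t y" by (simp add: chan_def)

lemma chan_commute: "chan s t = chan t s"
  by (cases s; cases t) (simp_all add: chan_def fun_eq_iff)

text \<open>The law of the output when one user sends \<open>s\<close> and the other sends 1 with probability \<open>r\<close>.\<close>

definition mix :: "bool \<Rightarrow> real \<Rightarrow> nat \<Rightarrow> real" where
  "mix s r y = (if y = Suc (of_bool s) then 1/2 else if y = of_bool s then (1 - r) / 2
     else if y = Suc (Suc (of_bool s)) then r / 2 else 0)"

lemma sum_mix: "(\<Sum>y<4. mix s r y) = 1"
  by (cases s) (simp_all add: lessThan_4 mix_def numeral_2_eq_2 numeral_3_eq_3 field_simps)

lemma mix_nonneg: "0 \<le> r \<Longrightarrow> r \<le> 1 \<Longrightarrow> 0 \<le> mix s r y"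
  by (simp add: mix_def)

text \<open>The letter \<open>Suc (of_bool s)\<close> is possible for both values of
  \<open>t\<close>, has probability 1/2 and says nothing about \<open>t\<close>. Only the other
  letter reveals \<open>t\<close>, whence the factors 1/2 in the rate bounds. Which output is which
  depends on \<open>t\<close>, so the pairs are unordered.\<close>

lemma mix_at_outputs:
  fixes r defines "p t \<equiv> if t then r else 1 - r"
  shows "{mix s r (of_bool s + of_bool t), mix s r (Suc (of_bool s + of_bool t))} = {1 / 2, p t / 2}"
  by (cases s; cases t) (auto simp: mix_def p_def)

lemma mix_pos:
  assumes "0 < (if t then r else 1 - r)"
  shows "0 < mix s r (of_bool s + of_bool t)" "0 < mix s r (Suc (of_bool s + of_bool t))"
  using mix_at_outputs[of s r t] assms by (auto simp: doubleton_eq_iff)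

lemma log_mix:
  "log 2 (2 * mix s r (of_bool s + of_bool t)) + log 2 (2 * mix s r (Suc (of_bool s + of_bool t)))
    = log 2 (if t then r else 1 - r)"
proof -
  have "log 2 (2 * x) + log 2 (2 * y) = log 2 p" if "{x, y} = {1 / 2, p / 2}" for x y p :: real
  proof -
    from that consider "2 * x = 1" "2 * y = p" | "2 * x = p" "2 * y = 1"
      by (auto simp: doubleton_eq_iff)
    thus ?thesis by cases simp_all
  qed
  thus ?thesis using mix_at_outputs by blast
qed

text \<open>At \<open>v = (1 - u) / 2\<close> this is the output law when the inputs differ with
  probability \<open>u\<close> and the pairs 00 and 11 are equally likely.\<close>

definition sum_law :: "real \<Rightarrow> nat \<Rightarrow> real" where
  "sum_law v y = (if y = 0 \<or> y = 3 then v / 2 else (1 - v) / 2)"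

lemma sum_sum_law: "(\<Sum>y<4. sum_law v y) = 1"
  by (simp add: lessThan_4 sum_law_def field_simps)

section \<open>Divergence bounds for the two-user code\<close>

text \<open>The encoders \<open>a\<close> and \<open>b\<close> read off the time from the length of
  the history. The locale can also be instantiated with the users exchanged.\<close>

locale two_user_code =
  fixes M1 M2 n :: nat and a b :: "nat \<Rightarrow> nat list \<Rightarrow> bool"
  assumes M1_pos: "1 \<le> M1" and M2_pos: "1 \<le> M2" and n_pos: "1 \<le> n"
begin

definition lik :: "nat \<Rightarrow> nat \<Rightarrow> nat list \<Rightarrow> real" where
  "lik w1 w2 = path_prob (\<lambda>ys. chan (a w1 ys) (b w2 ys))"

lemma lik_Nil [simp]: "lik w1 w2 [] = 1"
  by (simp add: lik_def)

lemma lik_snoc [simp]: "lik w1 w2 (ys @ [y]) = lik w1 w2 ys * chan (a w1 ys) (b w2 ys) y"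
  by (simp add: lik_def)

lemma lik_nonneg [simp]: "0 \<le> lik w1 w2 ys"
  by (simp add: lik_def path_prob_nonneg)

lemma sum_lik_words: "sum (lik w1 w2) (words k) = 1"
  unfolding lik_def by (rule sum_path_prob_words) (simp add: sum_chan_1)

section \<open>Expectations at the end of the block and at a random time\<close>

definition final_exp :: "(nat \<Rightarrow> nat \<Rightarrow> nat list \<Rightarrow> real) \<Rightarrow> real" where
  "final_exp F = (\<Sum>w1\<in>{1..M1}. \<Sum>w2\<in>{1..M2}. \<Sum>ys\<in>words n. lik w1 w2 ys * F w1 w2 ys) / (M1 * M2)"

text \<open>The average over the messages, the channel noise and a uniformly distributed time.\<close>

definition avg :: "(nat \<Rightarrow> nat \<Rightarrow> nat list \<Rightarrow> real) \<Rightarrow> real" where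
  "avg F = (\<Sum>w1\<in>{1..M1}. \<Sum>w2\<in>{1..M2}. \<Sum>ys\<in>short_words n. lik w1 w2 ys * F w1 w2 ys) / (M1 * M2 * n)"

lemma final_exp_mono:
  assumes "\<And>w1 w2 ys. w1 \<in> {1..M1} \<Longrightarrow> w2 \<in> {1..M2} \<Longrightarrow> ys \<in> words n \<Longrightarrow> lik w1 w2 ys > 0 \<Longrightarrow>
    F w1 w2 ys \<le> G w1 w2 ys"
  shows "final_exp F \<le> final_exp G"
  unfolding final_exp_def
proof (intro divide_right_mono sum_mono)
  fix w1 w2 ys assume "w1 \<in> {1..M1}" "w2 \<in> {1..M2}" "ys \<in> words n"
  thus "lik w1 w2 ys * F w1 w2 ys \<le> lik w1 w2 ys * G w1 w2 ys"
    using assms[of w1 w2 ys] lik_nonneg[of w1 w2 ys]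
    by (cases "lik w1 w2 ys = 0") (auto intro!: mult_left_mono)
qed simp

lemma final_exp_1: "final_exp (\<lambda>_ _ _. 1) = 1"
  using M1_pos M2_pos by (simp add: final_exp_def sum_lik_words)

lemma final_exp_add: "final_exp (\<lambda>w1 w2 ys. F w1 w2 ys + G w1 w2 ys) = final_exp F + final_exp G"
  by (simp add: final_exp_def distrib_left sum.distrib add_divide_distrib)

lemma final_exp_diff: "final_exp (\<lambda>w1 w2 ys. F w1 w2 ys - G w1 w2 ys) = final_exp F - final_exp G"
  by (simp add: final_exp_def right_diff_distrib sum_subtractf diff_divide_distrib)

lemma final_exp_cmult: "final_exp (\<lambda>w1 w2 ys. c * F w1 w2 ys) = c * final_exp F"
  by (simp add: final_exp_def sum_distrib_left mult.left_commute)

lemma avg_cong: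
  assumes "\<And>w1 w2 ys. w1 \<in> {1..M1} \<Longrightarrow> w2 \<in> {1..M2} \<Longrightarrow> ys \<in> short_words n \<Longrightarrow> lik w1 w2 ys > 0 \<Longrightarrow>
    F w1 w2 ys = G w1 w2 ys"
  shows "avg F = avg G"
  unfolding avg_def
proof (intro arg_cong2[where f = divide] sum.cong refl)
  fix w1 w2 ys assume "w1 \<in> {1..M1}" "w2 \<in> {1..M2}" "ys \<in> short_words n"
  thus "lik w1 w2 ys * F w1 w2 ys = lik w1 w2 ys * G w1 w2 ys"
    using assms[of w1 w2 ys] lik_nonneg[of w1 w2 ys]
    by (cases "lik w1 w2 ys = 0") auto
qed

lemma avg_mono:
  assumes "\<And>w1 w2 ys. w1 \<in> {1..M1} \<Longrightarrow> w2 \<in> {1..M2} \<Longrightarrow> ys \<in> short_words n \<Longrightarrow> F w1 w2 ys \<le> G w1 w2 ys"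
  shows "avg F \<le> avg G"
  unfolding avg_def by (intro divide_right_mono sum_mono mult_left_mono assms) auto

lemma avg_add: "avg (\<lambda>w1 w2 ys. F w1 w2 ys + G w1 w2 ys) = avg F + avg G"
  by (simp add: avg_def distrib_left sum.distrib add_divide_distrib)

lemma avg_diff: "avg (\<lambda>w1 w2 ys. F w1 w2 ys - G w1 w2 ys) = avg F - avg G"
  by (simp add: avg_def right_diff_distrib sum_subtractf diff_divide_distrib)

lemma avg_cmult: "avg (\<lambda>w1 w2 ys. c * F w1 w2 ys) = c * avg F"
  by (simp add: avg_def sum_distrib_left mult.left_commute)

lemma sum_lik_short_words: "sum (lik w1 w2) (short_words k) = k"
  by (induction k) (simp_all add: sum_short_words_Suc sum_lik_words)

lemma avg_1: "avg (\<lambda>_ _ _. 1) = 1"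
  using M1_pos M2_pos n_pos by (simp add: avg_def sum_lik_short_words)

lemma avg_const: "avg (\<lambda>_ _ _. c) = c"
  using avg_cmult[of c "\<lambda>_ _ _. 1"] by (simp add: avg_1)

text \<open>Dynkin's formula for the channel, whose two possible next letters have probability 1/2
  each. A log-likelihood at the end of the block becomes \<open>n\<close> times the average of its
  one-step increments.\<close>

lemma final_exp_increments:
  assumes "\<And>w1 w2. F w1 w2 [] = 0"
  shows "final_exp F = n * avg (\<lambda>w1 w2 ys.
    (F w1 w2 (ys @ [of_bool (a w1 ys) + of_bool (b w2 ys)]) +
     F w1 w2 (ys @ [Suc (of_bool (a w1 ys) + of_bool (b w2 ys))])) / 2 - F w1 w2 ys)"
proof -
  define G where "G = (\<lambda>w1 w2 ys.
    (F w1 w2 (ys @ [of_bool (a w1 ys) + of_bool (b w2 ys)]) +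
     F w1 w2 (ys @ [Suc (of_bool (a w1 ys) + of_bool (b w2 ys))])) / 2 - F w1 w2 ys)"
  have G: "(\<Sum>y<4. chan (a w1 ys) (b w2 ys) y * (F w1 w2 (ys @ [y]) - F w1 w2 ys)) = G w1 w2 ys" for w1 w2 ys
    unfolding G_def sum_chan by (simp add: field_simps)
  have "(\<Sum>ys\<in>words n. lik w1 w2 ys * F w1 w2 ys) = (\<Sum>ys\<in>short_words n. lik w1 w2 ys * G w1 w2 ys)" for w1 w2
    unfolding lik_def
    using sum_path_prob_words_increments[of "\<lambda>ys. chan (a w1 ys) (b w2 ys)" "F w1 w2" n]
    by (simp only: G assms sum_chan_1 add_0)
  hence "final_exp F = n * avg G"
    unfolding final_exp_def avg_def using n_pos by simp
  thus ?thesis by (simp only: G_def)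
qed

section \<open>Success probability against divergence\<close>

abbreviation out :: "nat \<Rightarrow> nat \<Rightarrow> nat list \<Rightarrow> nat" where
  "out w1 w2 ys \<equiv> of_bool (a w1 ys) + of_bool (b w2 ys)"

definition success :: "(nat list \<Rightarrow> nat \<times> nat) \<Rightarrow> real" where
  "success g = final_exp (\<lambda>w1 w2 ys. of_bool (g ys = (w1, w2)))"

text \<open>
  The likelihood ratio \<open>\<Lambda>\<close> describes a second measure under which the decoder \<open>g\<close> succeeds with
  probability at most \<open>1 / M\<close>. Applying \<open>ln x \<le> x - 1\<close> to \<open>\<Lambda>\<close>, reweighted by \<open>(1 + M) / 2\<close> on the
  event of correct decoding and by \<open>1 / 2\<close> off it, bounds the divergence from below.
\<close>

lemma success_le_divergence:
  assumes pos: "\<And>w1 w2 ys. w1 \<in> {1..M1} \<Longrightarrow> w2 \<in> {1..M2} \<Longrightarrow> lik w1 w2 ys > 0 \<Longrightarrow> \<Lambda> w1 w2 ys > 0"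
    and total: "final_exp \<Lambda> \<le> 1"
    and dec: "final_exp (\<lambda>w1 w2 ys. \<Lambda> w1 w2 ys * of_bool (g ys = (w1, w2))) \<le> 1 / M"
    and M: "0 < M"
  shows "success g * log 2 M - 1 \<le> - final_exp (\<lambda>w1 w2 ys. log 2 (\<Lambda> w1 w2 ys))"
proof -
  define s :: "nat \<Rightarrow> nat \<Rightarrow> nat list \<Rightarrow> real" where "s = (\<lambda>w1 w2 ys. of_bool (g ys = (w1, w2)))"
  have pw: "log 2 l + (log 2 M * of_bool c - 1) \<le> (1 / (2 * ln 2)) * (l + M * (l * of_bool c)) - 1 / ln 2"
    if l: "0 < l" for l :: real and c
  proof -
    \<comment> \<open>On correct decoding log((1 + M) / 2) is at least log M - 1; otherwise the
      weight 1/2 gives exactly -1.\<close>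
    have "log 2 M * of_bool c - 1 \<le> log 2 ((1 + M * of_bool c) / 2)"
      using M by (cases c) (simp_all add: log_divide)
    hence "log 2 l + (log 2 M * of_bool c - 1) \<le> log 2 (l * ((1 + M * of_bool c) / 2))"
      using l M by (subst log_mult) (auto simp: add_pos_nonneg)
    also have "\<dots> \<le> (l * ((1 + M * of_bool c) / 2) - 1) / ln 2"
      unfolding log_def using l M by (intro divide_right_mono ln_le_minus_one) (auto simp: add_pos_nonneg)
    also have "\<dots> = (1 / (2 * ln 2)) * (l + M * (l * of_bool c)) - 1 / ln 2"
      by (simp add: diff_divide_distrib distrib_left mult_ac)
    finally show ?thesis .
  qed
  have "final_exp (\<lambda>w1 w2 ys. log 2 (\<Lambda> w1 w2 ys) + (log 2 M * s w1 w2 ys - 1)) \<le>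
    final_exp (\<lambda>w1 w2 ys. (1 / (2 * ln 2)) * (\<Lambda> w1 w2 ys + M * (\<Lambda> w1 w2 ys * s w1 w2 ys)) - (1 / ln 2) * 1)"
    unfolding s_def mult_1_right by (rule final_exp_mono) (rule pw[OF pos])
  also have "\<dots> = (1 / (2 * ln 2)) * (final_exp \<Lambda> + M * final_exp (\<lambda>w1 w2 ys. \<Lambda> w1 w2 ys * s w1 w2 ys)) - 1 / ln 2"
    unfolding final_exp_diff final_exp_cmult final_exp_add final_exp_1 by simp
  \<comment> \<open>Both masses, the second after scaling by \<open>M\<close>, are at most 1, and
    together they cancel \<open>1 / ln 2\<close>.\<close>
  also have "\<dots> \<le> (1 / (2 * ln 2)) * (1 + M * (1 / M)) - 1 / ln 2"
    using total dec M unfolding s_def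
    by (intro diff_right_mono mult_left_mono add_mono) auto
  also have "\<dots> = 0" using M by simp
  finally show ?thesis
    unfolding final_exp_diff final_exp_cmult final_exp_add final_exp_1 success_def s_def
    by (simp only: mult.commute[of "log 2 M"])
qed

lemma lik_snoc_pos:
  assumes "lik w1 w2 (ys @ [y]) > 0"
  shows "lik w1 w2 ys > 0" "y = out w1 w2 ys \<or> y = Suc (out w1 w2 ys)"
  using assms by (auto simp: chan_def zero_less_mult_iff split: if_splits)

lemma lik_out:
  "lik w1 w2 (ys @ [out w1 w2 ys]) = lik w1 w2 ys / 2"
  "lik w1 w2 (ys @ [Suc (out w1 w2 ys)]) = lik w1 w2 ys / 2"
  by (simp_all add: chan_def)

text \<open>The reference measure draws the output from \<open>K\<close>. A true transition has
  probability 1/2, so each step multiplies the likelihood ratio by \<open>2 * K\<close>, and the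
  increments of its logarithm are the single-letter terms of the bound.\<close>

lemma success_le_kernel_divergence:
  fixes K :: "nat \<Rightarrow> nat \<Rightarrow> nat list \<Rightarrow> nat \<Rightarrow> real"
  assumes nonneg: "\<And>w1 w2 ys y. 0 \<le> K w1 w2 ys y"
    and total: "\<And>w1 w2 ys. (\<Sum>y<4. K w1 w2 ys y) = 1"
    and pos: "\<And>w1 w2 ys. w1 \<in> {1..M1} \<Longrightarrow> w2 \<in> {1..M2} \<Longrightarrow> lik w1 w2 ys > 0 \<Longrightarrow>
      0 < K w1 w2 ys (out w1 w2 ys) \<and> 0 < K w1 w2 ys (Suc (out w1 w2 ys))"
    and dec: "(\<Sum>w1\<in>{1..M1}. \<Sum>w2\<in>{1..M2}. \<Sum>ys\<in>words n. path_prob (K w1 w2) ys * of_bool (g ys = (w1, w2)))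
      \<le> real M1 * real M2 / M"
    and M: "0 < M"
  shows "success g * log 2 M - 1 \<le> n * avg (\<lambda>w1 w2 ys.
    - (log 2 (2 * K w1 w2 ys (out w1 w2 ys)) + log 2 (2 * K w1 w2 ys (Suc (out w1 w2 ys)))) / 2)"
proof -
  define \<Lambda> where "\<Lambda> = (\<lambda>w1 w2 ys. path_prob (K w1 w2) ys / lik w1 w2 ys)"
  have path_nonneg: "0 \<le> path_prob (K w1 w2) ys" for w1 w2 ys
    by (rule path_prob_nonneg) (rule nonneg)
  have path_pos: "0 < path_prob (K w1 w2) ys" if "w1 \<in> {1..M1}" "w2 \<in> {1..M2}" "lik w1 w2 ys > 0" for w1 w2 ys
    using that(3)
  proof (induction ys rule: rev_induct)
    case (snoc y ys)
    thus ?case using lik_snoc_pos[OF snoc.prems] pos[OF that(1,2), of ys] by auto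
  qed simp
  \<comment> \<open>Only an inequality: where \<open>lik\<close> vanishes, division by zero makes
    \<open>\<Lambda>\<close> equal to 0.\<close>
  have lik_\<Lambda>: "lik w1 w2 ys * \<Lambda> w1 w2 ys \<le> path_prob (K w1 w2) ys" for w1 w2 ys
    using path_nonneg by (simp add: \<Lambda>_def)
  have avg_log: "(log 2 (l * (2 * x)) + log 2 (l * (2 * y))) / 2 - log 2 l = (-1) * (- (log 2 (2 * x) + log 2 (2 * y)) / 2)"
    if "0 < l" "0 < x" "0 < y" for l x y :: real
    using that by (simp add: log_mult_pos add_divide_distrib)
  have \<Lambda>_pos: "0 < \<Lambda> w1 w2 ys" if "w1 \<in> {1..M1}" "w2 \<in> {1..M2}" "lik w1 w2 ys > 0" for w1 w2 ys
    using path_pos[OF that] that by (simp add: \<Lambda>_def)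
  have "success g * log 2 M - 1 \<le> - final_exp (\<lambda>w1 w2 ys. log 2 (\<Lambda> w1 w2 ys))"
  proof (rule success_le_divergence[OF \<Lambda>_pos _ _ M])
    have "final_exp \<Lambda> \<le> (\<Sum>w1\<in>{1..M1}. \<Sum>w2\<in>{1..M2}. \<Sum>ys\<in>words n. path_prob (K w1 w2) ys) / (M1 * M2)"
      unfolding final_exp_def using lik_\<Lambda> by (intro divide_right_mono sum_mono) auto
    also have "\<dots> = 1" using M1_pos M2_pos by (simp add: sum_path_prob_words total)
    finally show "final_exp \<Lambda> \<le> 1" .
    have "final_exp (\<lambda>w1 w2 ys. \<Lambda> w1 w2 ys * of_bool (g ys = (w1, w2))) \<le>
      (\<Sum>w1\<in>{1..M1}. \<Sum>w2\<in>{1..M2}. \<Sum>ys\<in>words n. path_prob (K w1 w2) ys * of_bool (g ys = (w1, w2))) / (M1 * M2)"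
      unfolding final_exp_def mult.assoc[symmetric] using lik_\<Lambda>
      by (intro divide_right_mono sum_mono mult_right_mono) auto
    also have "\<dots> \<le> (real M1 * real M2 / M) / (M1 * M2)"
      using dec by (intro divide_right_mono) auto
    also have "\<dots> = 1 / M" using M1_pos M2_pos by simp
    finally show "final_exp (\<lambda>w1 w2 ys. \<Lambda> w1 w2 ys * of_bool (g ys = (w1, w2))) \<le> 1 / M" .
  qed
  also have "final_exp (\<lambda>w1 w2 ys. log 2 (\<Lambda> w1 w2 ys)) = n * avg (\<lambda>w1 w2 ys.
    (log 2 (\<Lambda> w1 w2 (ys @ [out w1 w2 ys])) + log 2 (\<Lambda> w1 w2 (ys @ [Suc (out w1 w2 ys)]))) / 2 - log 2 (\<Lambda> w1 w2 ys))"
    by (rule final_exp_increments) (simp add: \<Lambda>_def)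
  also have "avg (\<lambda>w1 w2 ys.
    (log 2 (\<Lambda> w1 w2 (ys @ [out w1 w2 ys])) + log 2 (\<Lambda> w1 w2 (ys @ [Suc (out w1 w2 ys)]))) / 2 - log 2 (\<Lambda> w1 w2 ys))
    = avg (\<lambda>w1 w2 ys. (-1) *
    (- (log 2 (2 * K w1 w2 ys (out w1 w2 ys)) + log 2 (2 * K w1 w2 ys (Suc (out w1 w2 ys)))) / 2))"
  proof (rule avg_cong)
    fix w1 w2 ys assume w: "w1 \<in> {1..M1}" "w2 \<in> {1..M2}" "lik w1 w2 ys > 0"
    have "\<Lambda> w1 w2 (ys @ [out w1 w2 ys]) = \<Lambda> w1 w2 ys * (2 * K w1 w2 ys (out w1 w2 ys))"
      "\<Lambda> w1 w2 (ys @ [Suc (out w1 w2 ys)]) = \<Lambda> w1 w2 ys * (2 * K w1 w2 ys (Suc (out w1 w2 ys)))"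
      unfolding \<Lambda>_def lik_out by (simp_all del: lik_snoc)
    thus "(log 2 (\<Lambda> w1 w2 (ys @ [out w1 w2 ys])) + log 2 (\<Lambda> w1 w2 (ys @ [Suc (out w1 w2 ys)]))) / 2 - log 2 (\<Lambda> w1 w2 ys)
      = (-1) * (- (log 2 (2 * K w1 w2 ys (out w1 w2 ys)) + log 2 (2 * K w1 w2 ys (Suc (out w1 w2 ys)))) / 2)"
      using pos[OF w] \<Lambda>_pos[OF w] by (simp only: avg_log)
  qed
  finally show ?thesis unfolding avg_cmult by simp
qed

section \<open>Bounds through the frequency of unequal inputs\<close>

definition mismatch :: real where
  "mismatch = avg (\<lambda>w1 w2 ys. of_bool (a w1 ys \<noteq> b w2 ys))"

lemma avg_mismatch_split:
  "avg (\<lambda>w1 w2 ys. if a w1 ys \<noteq> b w2 ys then x else y) = mismatch * x + (1 - mismatch) * y"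
proof -
  have "avg (\<lambda>w1 w2 ys. if a w1 ys \<noteq> b w2 ys then x else y) =
      avg (\<lambda>w1 w2 ys. y * 1 + (x - y) * of_bool (a w1 ys \<noteq> b w2 ys))"
    by (rule avg_cong) simp
  also have "\<dots> = y + (x - y) * mismatch"
    unfolding avg_add avg_cmult avg_1 mismatch_def by simp
  finally show ?thesis by (simp add: algebra_simps)
qed

lemma mismatch_range: "0 \<le> mismatch" "mismatch \<le> 1"
  using avg_mono[of "\<lambda>_ _ _. 0" "\<lambda>w1 w2 ys. of_bool (a w1 ys \<noteq> b w2 ys)"]
    avg_mono[of "\<lambda>w1 w2 ys. of_bool (a w1 ys \<noteq> b w2 ys)" "\<lambda>_ _ _. 1"]
  by (auto simp: avg_const mismatch_def)

text \<open>The reference output is i.i.d. with law \<open>sum_law v\<close> and ignores both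
  messages, so the pair is guessed with probability at most \<open>1 / (M1 * M2)\<close>. Unequal
  inputs lead to the letters 1 and 2, equal inputs to one outer and one inner letter.\<close>

lemma success_le_sum_entropy:
  "success g * log 2 (real M1 * real M2) - 1 \<le> n * bin_entropy ((1 - mismatch) / 2)"
proof -
  have "(success g * log 2 (real M1 * real M2) - 1) / n \<le> bin_entropy ((1 - mismatch) / 2)"
  proof (rule le_bin_entropy_if_le_cross_entropy)
    fix v :: real assume v: "0 < v" "v < 1"
    have "success g * log 2 (real M1 * real M2) - 1 \<le> n * avg (\<lambda>w1 w2 ys.
      - (log 2 (2 * sum_law v (out w1 w2 ys)) + log 2 (2 * sum_law v (Suc (out w1 w2 ys)))) / 2)"
    proof (rule success_le_kernel_divergence[where K = "\<lambda>_ _ _. sum_law v"])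
      have "(\<Sum>w1\<in>{1..M1}. \<Sum>w2\<in>{1..M2}. \<Sum>ys\<in>words n. path_prob (\<lambda>_. sum_law v) ys * of_bool (g ys = (w1, w2)))
        = (\<Sum>ys\<in>words n. path_prob (\<lambda>_. sum_law v) ys * (\<Sum>(w1, w2)\<in>{1..M1} \<times> {1..M2}. of_bool (g ys = (w1, w2))))"
        unfolding sum_swap_third[where C = "words n"] sum.cartesian_product[symmetric] sum_distrib_left ..
      also have "\<dots> \<le> (\<Sum>ys\<in>words n. path_prob (\<lambda>_. sum_law v) ys * 1)"
      proof (intro sum_mono mult_left_mono path_prob_nonneg)
        fix ys
        have "(\<Sum>w\<in>{1..M1} \<times> {1..M2}. of_bool (g ys = w)) \<le> (1::real)"
          by (simp add: of_bool_def sum.delta)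
        thus "(\<Sum>(w1, w2)\<in>{1..M1} \<times> {1..M2}. of_bool (g ys = (w1, w2))) \<le> (1::real)"
          by (simp add: case_prod_unfold)
      qed (use v in \<open>auto simp: sum_law_def\<close>)
      also have "\<dots> = 1" by (simp add: sum_path_prob_words sum_sum_law)
      finally show "(\<Sum>w1\<in>{1..M1}. \<Sum>w2\<in>{1..M2}. \<Sum>ys\<in>words n. path_prob (\<lambda>_. sum_law v) ys * of_bool (g ys = (w1, w2)))
        \<le> real M1 * real M2 / (real M1 * real M2)" using M1_pos M2_pos by simp
    qed (use v M1_pos M2_pos in \<open>auto simp: sum_law_def sum_sum_law[unfolded sum_law_def]\<close>)
    also have "avg (\<lambda>w1 w2 ys.
      - (log 2 (2 * sum_law v (out w1 w2 ys)) + log 2 (2 * sum_law v (Suc (out w1 w2 ys)))) / 2) =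
      avg (\<lambda>w1 w2 ys. if a w1 ys \<noteq> b w2 ys then - log 2 (1 - v) else - (log 2 v + log 2 (1 - v)) / 2)"
      by (rule avg_cong) (auto simp: sum_law_def diff_divide_distrib)
    also have "\<dots> = - ((1 - mismatch) / 2) * log 2 v - (1 - (1 - mismatch) / 2) * log 2 (1 - v)"
      unfolding avg_mismatch_split by (simp add: field_simps)
    finally show "(success g * log 2 (real M1 * real M2) - 1) / n \<le>
       - ((1 - mismatch) / 2) * log 2 v - (1 - (1 - mismatch) / 2) * log 2 (1 - v)"
      using n_pos by (simp add: pos_divide_le_eq mult.commute)
  qed (use mismatch_range in auto)
  thus ?thesis using n_pos by (simp add: pos_divide_le_eq mult.commute)
qed

lemma success_le_half_mismatch_entropy:
  "success g * log 2 M1 - 1 \<le> n * (1/2 * bin_entropy mismatch)"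
proof -
  have "2 * (success g * log 2 M1 - 1) / n \<le> bin_entropy mismatch"
  proof (rule le_bin_entropy_if_le_cross_entropy)
    fix v :: real assume v: "0 < v" "v < 1"
    \<comment> \<open>Reference law in which user 1 sends the complement of the input of user 2 with
      probability \<open>v\<close>. Of the messages it uses only \<open>w2\<close>, so
      \<open>w1\<close> is guessed with probability at most \<open>1 / M1\<close>.\<close>
    define K where "K = (\<lambda>w2 ys. mix (b w2 ys) (if b w2 ys then 1 - v else v))"
    have K_nonneg: "0 \<le> K w2 ys y" for w2 ys y using v by (auto simp: K_def intro: mix_nonneg)
    have "success g * log 2 M1 - 1 \<le> n * avg (\<lambda>w1 w2 ys.
      - (log 2 (2 * K w2 ys (out w1 w2 ys)) + log 2 (2 * K w2 ys (Suc (out w1 w2 ys)))) / 2)"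
    proof (rule success_le_kernel_divergence[where K = "\<lambda>_ w2 ys. K w2 ys"])
      have "(\<Sum>w1\<in>{1..M1}. \<Sum>w2\<in>{1..M2}. \<Sum>ys\<in>words n. path_prob (K w2) ys * of_bool (g ys = (w1, w2)))
        = (\<Sum>w2\<in>{1..M2}. \<Sum>ys\<in>words n. path_prob (K w2) ys * (\<Sum>w1\<in>{1..M1}. of_bool (g ys = (w1, w2))))"
        by (subst sum.swap, intro sum.cong refl, subst sum.swap) (simp only: sum_distrib_left)
      also have "\<dots> \<le> (\<Sum>w2\<in>{1..M2}. \<Sum>ys\<in>words n. path_prob (K w2) ys * 1)"
      proof (intro sum_mono mult_left_mono path_prob_nonneg K_nonneg)
        fix w2 ys
        have "(\<Sum>w1\<in>{1..M1}. of_bool (g ys = (w1, w2))) \<le> (\<Sum>w1\<in>{1..M1}. of_bool (fst (g ys) = w1) :: real)"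
          by (intro sum_mono) auto
        also have "\<dots> \<le> 1" by (simp add: of_bool_def sum.delta)
        finally show "(\<Sum>w1\<in>{1..M1}. of_bool (g ys = (w1, w2))) \<le> (1::real)" .
      qed
      also have "\<dots> = M2" by (simp add: sum_path_prob_words K_def sum_mix)
      finally show "(\<Sum>w1\<in>{1..M1}. \<Sum>w2\<in>{1..M2}. \<Sum>ys\<in>words n. path_prob (K w2) ys * of_bool (g ys = (w1, w2)))
        \<le> real M1 * real M2 / real M1" using M1_pos by simp
      fix w1 w2 ys
      show "0 < K w2 ys (out w1 w2 ys) \<and> 0 < K w2 ys (Suc (out w1 w2 ys))"
        unfolding K_def add.commute[of "of_bool (a w1 ys)"] using v by (intro conjI mix_pos) auto
    qed (use M1_pos K_nonneg in \<open>auto simp: K_def sum_mix\<close>)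
    also have "avg (\<lambda>w1 w2 ys.
      - (log 2 (2 * K w2 ys (out w1 w2 ys)) + log 2 (2 * K w2 ys (Suc (out w1 w2 ys)))) / 2) =
      avg (\<lambda>w1 w2 ys. if a w1 ys \<noteq> b w2 ys then - log 2 v / 2 else - log 2 (1 - v) / 2)"
      unfolding K_def add.commute[of "of_bool (a _ _)"] log_mix by (rule avg_cong) auto
    also have "n * \<dots> = n * ((- mismatch * log 2 v - (1 - mismatch) * log 2 (1 - v)) / 2)"
      unfolding avg_mismatch_split by (simp add: field_simps)
    finally show "2 * (success g * log 2 M1 - 1) / n \<le> - mismatch * log 2 v - (1 - mismatch) * log 2 (1 - v)"
      using n_pos by (simp add: pos_divide_le_eq mult.commute)
  qed (use mismatch_range in auto)
  thus ?thesis using n_pos by (simp add: pos_divide_le_eq mult.commute)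
qed

section \<open>Posteriors of the two inputs\<close>

text \<open>
  Probability that the second user sends 1, given the first message and the feedback. It depends on
  the message only through the past inputs of the first user (\<open>post2_cong\<close>).
\<close>

definition post2 :: "nat \<Rightarrow> nat list \<Rightarrow> real" where
  "post2 w1 ys = (\<Sum>w2\<in>{1..M2}. lik w1 w2 ys * of_bool (b w2 ys)) / (\<Sum>w2\<in>{1..M2}. lik w1 w2 ys)"

text \<open>The range \<open>i < length ys\<close> leaves out the input about to be sent. Fixing
  \<open>ys\<close> and a class of this relation is conditioning on T.\<close>

definition same_inputs :: "nat \<Rightarrow> nat \<Rightarrow> nat list \<Rightarrow> bool" where
  "same_inputs w w' ys \<longleftrightarrow> (\<forall>i<length ys. a w (take i ys) = a w' (take i ys))"

definition msg_class :: "nat \<Rightarrow> nat list \<Rightarrow> nat set" where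
  "msg_class w ys = {w'\<in>{1..M1}. same_inputs w w' ys}"

text \<open>
  Probability that the first user sends 1, given the feedback and the past inputs of the first user.
  In contrast to \<open>post2\<close>, the message itself may not be used, since it determines the input.
\<close>

definition post1 :: "nat \<Rightarrow> nat list \<Rightarrow> real" where
  "post1 w ys = (\<Sum>w'\<in>msg_class w ys. of_bool (a w' ys)) / card (msg_class w ys)"

lemma post2_range: "0 \<le> post2 w ys" "post2 w ys \<le> 1"
  unfolding post2_def by (intro sum_of_bool_range; simp)+

lemma post1_range: "0 \<le> post1 w ys" "post1 w ys \<le> 1"
  using sum_of_bool_range[of "msg_class w ys" "\<lambda>_. 1" "\<lambda>w'. a w' ys"] by (simp_all add: post1_def)

lemma post2_input_pos:
  assumes w2: "w2 \<in> {1..M2}" and pos: "lik w1 w2 ys > 0"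
  shows "0 < (if b w2 ys then post2 w1 ys else 1 - post2 w1 ys)"
proof -
  let ?S = "\<lambda>P. \<Sum>w\<in>{1..M2}. lik w1 w ys * of_bool (P w)"
  have S: "?S P > 0" if "P w2" for P
    using w2 pos that by (intro sum_pos2[of _ w2]) auto
  have tot: "(\<Sum>w\<in>{1..M2}. lik w1 w ys) > 0" using S[of "\<lambda>_. True"] by simp
  have "(\<Sum>w\<in>{1..M2}. lik w1 w ys) = ?S (\<lambda>w. b w ys) + ?S (\<lambda>w. \<not> b w ys)"
    by (subst sum.distrib[symmetric]) (intro sum.cong, auto)
  hence "1 - post2 w1 ys = ?S (\<lambda>w. \<not> b w ys) / (\<Sum>w\<in>{1..M2}. lik w1 w ys)"
    using tot by (simp add: post2_def field_simps)
  thus ?thesis using S[of "\<lambda>w. b w ys"] S[of "\<lambda>w. \<not> b w ys"] tot by (auto simp: post2_def)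
qed

text \<open>Tower property, as \<open>x\<close> and \<open>y\<close> do not depend on
  \<open>w2\<close>. If the total weight is zero, every summand vanishes and the default value of
  \<open>post2\<close> is harmless.\<close>

lemma sum_lik_input2:
  "(\<Sum>w2\<in>{1..M2}. lik w1 w2 ys * (if b w2 ys then x else y)) =
   (\<Sum>w2\<in>{1..M2}. lik w1 w2 ys * (post2 w1 ys * x + (1 - post2 w1 ys) * y))"
proof -
  let ?L = "\<Sum>w2\<in>{1..M2}. lik w1 w2 ys" and ?B = "\<Sum>w2\<in>{1..M2}. lik w1 w2 ys * of_bool (b w2 ys)"
  have B: "?B = post2 w1 ys * ?L"
  proof (cases "?L = 0")
    case True
    hence "lik w1 w2 ys = 0" if "w2 \<in> {1..M2}" for w2
      using that by (subst (asm) sum_nonneg_eq_0_iff) auto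
    thus ?thesis by simp
  qed (simp add: post2_def)
  have "(\<Sum>w2\<in>{1..M2}. lik w1 w2 ys * (if b w2 ys then x else y)) =
      (\<Sum>w2\<in>{1..M2}. y * lik w1 w2 ys + (x - y) * (lik w1 w2 ys * of_bool (b w2 ys)))"
    by (intro sum.cong) (auto simp: algebra_simps)
  also have "\<dots> = y * ?L + (x - y) * (post2 w1 ys * ?L)"
    unfolding sum.distrib sum_distrib_left[symmetric] B ..
  also have "\<dots> = ?L * (post2 w1 ys * x + (1 - post2 w1 ys) * y)" by (simp add: algebra_simps)
  finally show ?thesis by (simp only: sum_distrib_right)
qed

lemma avg_input2:
  "avg (\<lambda>w1 w2 ys. if b w2 ys then X w1 ys else Y w1 ys) =
   avg (\<lambda>w1 w2 ys. post2 w1 ys * X w1 ys + (1 - post2 w1 ys) * Y w1 ys)"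
  unfolding avg_def sum.swap[where A = "{1..M2}" and B = "short_words n"] sum_lik_input2 ..

lemma same_inputs_refl [simp]: "same_inputs w w ys"
  by (simp add: same_inputs_def)

lemma msg_class_cong: "same_inputs w w' ys \<Longrightarrow> msg_class w ys = msg_class w' ys"
  by (auto simp: msg_class_def same_inputs_def)

lemma finite_msg_class [simp]: "finite (msg_class w ys)"
  by (simp add: msg_class_def)

lemma card_msg_class_pos: "w \<in> {1..M1} \<Longrightarrow> 0 < card (msg_class w ys)"
  using card_gt_0_iff[of "msg_class w ys"] by (force simp: msg_class_def)

text \<open>The message of user 1 reaches the output only through its inputs. Given
  \<open>ys\<close> and any \<open>w2\<close>, the messages of one class are thus equally likely,
  which is the conditional independence of the two inputs given T.\<close>

lemma lik_cong: "same_inputs w w' ys \<Longrightarrow> lik w w2 ys = lik w' w2 ys"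
  unfolding lik_def path_prob_def by (intro prod.cong refl) (simp add: same_inputs_def)

lemma post2_cong: "same_inputs w w' ys \<Longrightarrow> post2 w ys = post2 w' ys"
  by (simp add: post2_def lik_cong)

lemma post1_cong: "same_inputs w w' ys \<Longrightarrow> post1 w ys = post1 w' ys"
  by (simp add: post1_def msg_class_cong)

lemma sum_msg_class_swap:
  fixes F :: "nat \<Rightarrow> nat \<Rightarrow> real"
  shows "(\<Sum>w\<in>{1..M1}. \<Sum>w'\<in>msg_class w ys. F w w') = (\<Sum>w'\<in>{1..M1}. \<Sum>w\<in>msg_class w' ys. F w w')"
proof -
  have "msg_class w' ys = {w\<in>{1..M1}. same_inputs w w' ys}" for w'
    by (auto simp: msg_class_def same_inputs_def)
  thus ?thesis
    using sum.swap_restrict[of "{1..M1}" "{1..M1}" F "\<lambda>w w'. same_inputs w w' ys"]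
    by (simp only: msg_class_def[of _ ys] finite_atLeastAtMost simp_thms)
qed

text \<open>Pairs of equivalent messages are summed in both orders; as \<open>G\<close> is constant
  on classes, averaging the indicator over each class preserves the sum.\<close>

lemma sum_input1:
  assumes "\<And>w w'. same_inputs w w' ys \<Longrightarrow> G w = G w'"
  shows "(\<Sum>w\<in>{1..M1}. G w * of_bool (a w ys)) = (\<Sum>w\<in>{1..M1}. G w * post1 w ys)"
proof -
  have "(\<Sum>w\<in>{1..M1}. G w * post1 w ys) =
      (\<Sum>w\<in>{1..M1}. \<Sum>w'\<in>msg_class w ys. G w * of_bool (a w' ys) / card (msg_class w ys))"
    by (simp only: post1_def times_divide_eq_right sum_distrib_left sum_divide_distrib)
  also have "\<dots> = (\<Sum>w'\<in>{1..M1}. \<Sum>w\<in>msg_class w' ys. G w * of_bool (a w' ys) / card (msg_class w ys))"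
    by (rule sum_msg_class_swap)
  also have "\<dots> = (\<Sum>w'\<in>{1..M1}. \<Sum>w\<in>msg_class w' ys. G w' * of_bool (a w' ys) / card (msg_class w' ys))"
  proof (intro sum.cong refl)
    fix w w' assume "w \<in> msg_class w' ys"
    hence "same_inputs w' w ys" by (simp add: msg_class_def)
    thus "G w * of_bool (a w' ys) / card (msg_class w ys) = G w' * of_bool (a w' ys) / card (msg_class w' ys)"
      using assms msg_class_cong by metis
  qed
  also have "\<dots> = (\<Sum>w'\<in>{1..M1}. G w' * of_bool (a w' ys))"
  proof (intro sum.cong refl)
    fix w' assume "w' \<in> {1..M1}"
    thus "(\<Sum>w\<in>msg_class w' ys. G w' * of_bool (a w' ys) / card (msg_class w' ys)) = G w' * of_bool (a w' ys)"
      using card_msg_class_pos[of w' ys] by (simp add: card_gt_0_iff)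
  qed
  finally show ?thesis ..
qed

lemma avg_input1:
  assumes X: "\<And>w w' ys. same_inputs w w' ys \<Longrightarrow> X w ys = X w' ys"
    and Y: "\<And>w w' ys. same_inputs w w' ys \<Longrightarrow> Y w ys = Y w' ys"
  shows "avg (\<lambda>w1 w2 ys. if a w1 ys then X w1 ys else Y w1 ys) =
    avg (\<lambda>w1 w2 ys. post1 w1 ys * X w1 ys + (1 - post1 w1 ys) * Y w1 ys)"
proof -
  have eq: "(\<Sum>w1\<in>{1..M1}. lik w1 w2 ys * (if a w1 ys then X w1 ys else Y w1 ys)) =
     (\<Sum>w1\<in>{1..M1}. lik w1 w2 ys * (post1 w1 ys * X w1 ys + (1 - post1 w1 ys) * Y w1 ys))" for w2 ys
  proof -
    let ?G = "\<lambda>w1. lik w1 w2 ys * (X w1 ys - Y w1 ys)"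
    have "(\<Sum>w1\<in>{1..M1}. lik w1 w2 ys * (if a w1 ys then X w1 ys else Y w1 ys)) =
        (\<Sum>w1\<in>{1..M1}. ?G w1 * of_bool (a w1 ys)) + (\<Sum>w1\<in>{1..M1}. lik w1 w2 ys * Y w1 ys)"
      by (subst sum.distrib[symmetric]) (intro sum.cong, auto simp: algebra_simps)
    also have "(\<Sum>w1\<in>{1..M1}. ?G w1 * of_bool (a w1 ys)) = (\<Sum>w1\<in>{1..M1}. ?G w1 * post1 w1 ys)"
      using lik_cong X Y by (intro sum_input1) metis
    also have "\<dots> + (\<Sum>w1\<in>{1..M1}. lik w1 w2 ys * Y w1 ys) =
        (\<Sum>w1\<in>{1..M1}. lik w1 w2 ys * (post1 w1 ys * X w1 ys + (1 - post1 w1 ys) * Y w1 ys))"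
      by (subst sum.distrib[symmetric]) (intro sum.cong, auto simp: algebra_simps)
    finally show ?thesis .
  qed
  have swap: "(\<Sum>w1\<in>{1..M1}. \<Sum>w2\<in>{1..M2}. \<Sum>ys\<in>short_words n. F w1 w2 ys) =
      (\<Sum>w2\<in>{1..M2}. \<Sum>ys\<in>short_words n. \<Sum>w1\<in>{1..M1}. F w1 w2 ys)" for F :: "nat \<Rightarrow> nat \<Rightarrow> nat list \<Rightarrow> real"
    unfolding sum_swap_third[where B = "{1..M2}"] sum_swap_third[where C = "{1..M1}"] ..
  show ?thesis unfolding avg_def swap eq ..
qed

text \<open>The reference kernel is the conditional law of the next letter given \<open>w1\<close>
  and the feedback. It does not involve \<open>w2\<close>, which is then guessed with probability at
  most \<open>1 / M2\<close>.\<close>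

lemma success_le_half_entropy_post2:
  "success g * log 2 M2 - 1 \<le> n * (1/2 * avg (\<lambda>w1 w2 ys. bin_entropy (post2 w1 ys)))"
proof -
  define K where "K = (\<lambda>w1 ys. mix (a w1 ys) (post2 w1 ys))"
  have K_nonneg: "0 \<le> K w1 ys y" for w1 ys y by (auto simp: K_def intro: mix_nonneg post2_range)
  have "success g * log 2 M2 - 1 \<le> n * avg (\<lambda>w1 w2 ys.
    - (log 2 (2 * K w1 ys (out w1 w2 ys)) + log 2 (2 * K w1 ys (Suc (out w1 w2 ys)))) / 2)"
  proof (rule success_le_kernel_divergence[where K = "\<lambda>w1 _ ys. K w1 ys"])
    have "(\<Sum>w1\<in>{1..M1}. \<Sum>w2\<in>{1..M2}. \<Sum>ys\<in>words n. path_prob (K w1) ys * of_bool (g ys = (w1, w2)))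
      = (\<Sum>w1\<in>{1..M1}. \<Sum>ys\<in>words n. path_prob (K w1) ys * (\<Sum>w2\<in>{1..M2}. of_bool (g ys = (w1, w2))))"
      by (intro sum.cong refl, subst sum.swap) (simp only: sum_distrib_left)
    also have "\<dots> \<le> (\<Sum>w1\<in>{1..M1}. \<Sum>ys\<in>words n. path_prob (K w1) ys * 1)"
    proof (intro sum_mono mult_left_mono path_prob_nonneg K_nonneg)
      fix w1 ys
      have "(\<Sum>w2\<in>{1..M2}. of_bool (g ys = (w1, w2))) \<le> (\<Sum>w2\<in>{1..M2}. of_bool (snd (g ys) = w2) :: real)"
        by (intro sum_mono) auto
      also have "\<dots> \<le> 1" by (simp add: of_bool_def sum.delta)
      finally show "(\<Sum>w2\<in>{1..M2}. of_bool (g ys = (w1, w2))) \<le> (1::real)" .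
    qed
    also have "\<dots> = M1" by (simp add: sum_path_prob_words K_def sum_mix)
    finally show "(\<Sum>w1\<in>{1..M1}. \<Sum>w2\<in>{1..M2}. \<Sum>ys\<in>words n. path_prob (K w1) ys * of_bool (g ys = (w1, w2)))
      \<le> real M1 * real M2 / real M2" using M2_pos by simp
    fix w1 w2 ys assume "w2 \<in> {1..M2}" "lik w1 w2 ys > 0"
    thus "0 < K w1 ys (out w1 w2 ys) \<and> 0 < K w1 ys (Suc (out w1 w2 ys))"
      unfolding K_def by (intro conjI mix_pos post2_input_pos)
  qed (use M2_pos K_nonneg in \<open>auto simp: K_def sum_mix\<close>)
  also have "avg (\<lambda>w1 w2 ys.
      - (log 2 (2 * K w1 ys (out w1 w2 ys)) + log 2 (2 * K w1 ys (Suc (out w1 w2 ys)))) / 2) =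
      avg (\<lambda>w1 w2 ys. if b w2 ys then - log 2 (post2 w1 ys) / 2 else - log 2 (1 - post2 w1 ys) / 2)"
    unfolding K_def log_mix by (rule avg_cong) auto
  also have "\<dots> = avg (\<lambda>w1 w2 ys. 1/2 * bin_entropy (post2 w1 ys))"
    unfolding avg_input2 bin_entropy_def by (simp add: field_simps)
  finally show ?thesis unfolding avg_cmult .
qed

lemma msg_class_Nil [simp]: "msg_class w [] = {1..M1}"
  by (auto simp: msg_class_def same_inputs_def)

lemma msg_class_snoc: "msg_class w (ys @ [y]) = {w' \<in> msg_class w ys. a w' ys = a w ys}"
  by (auto simp: msg_class_def same_inputs_def less_Suc_eq)

text \<open>\<open>post1\<close> is the share of the class that sends 1, so refining by the next
  input scales the class by the posterior of that input, whatever letter \<open>y\<close>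
  follows.\<close>

lemma card_msg_class_snoc:
  assumes "w \<in> {1..M1}"
  shows "real (card (msg_class w (ys @ [y]))) =
    card (msg_class w ys) * (if a w ys then post1 w ys else 1 - post1 w ys)"
proof -
  have c: "real (card {w'\<in>msg_class w ys. P w'}) = (\<Sum>w'\<in>msg_class w ys. of_bool (P w'))" for P
    by (simp add: of_bool_def sum.If_cases Int_def)
  have p: "card (msg_class w ys) * post1 w ys = (\<Sum>w'\<in>msg_class w ys. of_bool (a w' ys))"
    using card_msg_class_pos[OF assms, of ys] by (simp add: post1_def)
  have "(\<Sum>w'\<in>msg_class w ys. of_bool (\<not> a w' ys)) = (\<Sum>w'\<in>msg_class w ys. 1 - of_bool (a w' ys) :: real)"
    by (intro sum.cong) auto
  also have "\<dots> = card (msg_class w ys) * (1 - post1 w ys)"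
    by (simp add: sum_subtractf p right_diff_distrib del: sum_of_bool_eq)
  finally show ?thesis
    unfolding msg_class_snoc c using p by (cases "a w ys") (simp_all del: sum_of_bool_eq)
qed

text \<open>The ratio \<open>\<Lambda>\<close> belongs to the following measure: a fresh uniform
  message \<open>w\<close> replaces \<open>w1\<close> at the encoder, and the outcome is kept only
  if \<open>w\<close> sends the same inputs as \<open>w1\<close> would.\<close>

lemma success_le_entropy_post1:
  "success g * log 2 M1 - 1 \<le> n * avg (\<lambda>w1 w2 ys. bin_entropy (post1 w1 ys))"
proof -
  define \<Lambda> where "\<Lambda> = (\<lambda>(w1::nat) (w2::nat) ys. real (card (msg_class w1 ys)) / M1)"
  have \<Lambda>_pos: "0 < \<Lambda> w1 w2 ys" if "w1 \<in> {1..M1}" for w1 w2 ys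
    using card_msg_class_pos[OF that] M1_pos by (simp add: \<Lambda>_def)
  have "card (msg_class w1 ys) \<le> card {1..M1}" for w1 ys
    by (rule card_mono) (auto simp: msg_class_def)
  hence \<Lambda>_le: "\<Lambda> w1 w2 ys \<le> 1" for w1 w2 ys
    using M1_pos by (simp add: \<Lambda>_def)
  have "success g * log 2 M1 - 1 \<le> - final_exp (\<lambda>w1 w2 ys. log 2 (\<Lambda> w1 w2 ys))"
  proof (rule success_le_divergence[OF \<Lambda>_pos])
    show "final_exp \<Lambda> \<le> 1"
      using final_exp_mono[of \<Lambda> "\<lambda>_ _ _. 1"] \<Lambda>_le by (simp add: final_exp_1)
    let ?d = "\<lambda>w1 w2 ys. of_bool (g ys = (w1, w2)) :: real"
    have "(\<Sum>w1\<in>{1..M1}. \<Sum>w2\<in>{1..M2}. \<Sum>ys\<in>words n. lik w1 w2 ys * (\<Lambda> w1 w2 ys * ?d w1 w2 ys)) =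
        (\<Sum>w2\<in>{1..M2}. \<Sum>ys\<in>words n. \<Sum>w1\<in>{1..M1}. \<Sum>w\<in>msg_class w1 ys. lik w1 w2 ys * ?d w1 w2 ys / M1)"
      unfolding sum_swap_third[where B = "{1..M2}"] sum_swap_third[where C = "{1..M1}"]
      by (simp add: \<Lambda>_def mult_ac)
    \<comment> \<open>Equal likelihood within a class exchanges \<open>w1\<close> for
      \<open>w\<close>. Letting \<open>w\<close> then range over all messages makes the output
      independent of \<open>w1\<close>.\<close>
    also have "\<dots> = (\<Sum>w2\<in>{1..M2}. \<Sum>ys\<in>words n. \<Sum>w1\<in>{1..M1}. \<Sum>w\<in>msg_class w1 ys. lik w w2 ys * ?d w1 w2 ys / M1)"
      by (intro sum.cong refl) (metis (mono_tags, lifting) lik_cong mem_Collect_eq msg_class_def)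
    also have "\<dots> \<le> (\<Sum>w2\<in>{1..M2}. \<Sum>ys\<in>words n. \<Sum>w1\<in>{1..M1}. \<Sum>w\<in>{1..M1}. lik w w2 ys * ?d w1 w2 ys / M1)"
      by (intro sum_mono sum_mono2) (auto simp: msg_class_def)
    also have "\<dots> = (\<Sum>w2\<in>{1..M2}. \<Sum>ys\<in>words n. \<Sum>w\<in>{1..M1}. lik w w2 ys / M1 * (\<Sum>w1\<in>{1..M1}. ?d w1 w2 ys))"
      unfolding sum_distrib_left by (rule sum.cong[OF refl], rule sum.cong[OF refl], subst sum.swap) simp
    also have "\<dots> \<le> (\<Sum>w2\<in>{1..M2}. \<Sum>ys\<in>words n. \<Sum>w\<in>{1..M1}. lik w w2 ys / M1 * 1)"
    proof (intro sum_mono mult_left_mono)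
      fix w2 ys
      have "(\<Sum>w1\<in>{1..M1}. ?d w1 w2 ys) \<le> (\<Sum>w1\<in>{1..M1}. of_bool (fst (g ys) = w1))"
        by (intro sum_mono) auto
      also have "\<dots> \<le> 1" by (simp add: of_bool_def sum.delta)
      finally show "(\<Sum>w1\<in>{1..M1}. ?d w1 w2 ys) \<le> 1" .
    qed simp
    also have "\<dots> = (\<Sum>w2\<in>{1..M2}. \<Sum>w\<in>{1..M1}. (\<Sum>ys\<in>words n. lik w w2 ys) / M1)"
      unfolding sum_divide_distrib by (intro sum.cong refl, subst sum.swap) simp
    also have "\<dots> = M2" using M1_pos by (simp add: sum_lik_words)
    finally have "final_exp (\<lambda>w1 w2 ys. \<Lambda> w1 w2 ys * ?d w1 w2 ys) \<le> M2 / (M1 * M2)"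
      unfolding final_exp_def by (intro divide_right_mono) auto
    thus "final_exp (\<lambda>w1 w2 ys. \<Lambda> w1 w2 ys * ?d w1 w2 ys) \<le> 1 / M1"
      using M2_pos by simp
  qed (use M1_pos in auto)
  also have "final_exp (\<lambda>w1 w2 ys. log 2 (\<Lambda> w1 w2 ys)) = n * avg (\<lambda>w1 w2 ys.
    (log 2 (\<Lambda> w1 w2 (ys @ [out w1 w2 ys])) + log 2 (\<Lambda> w1 w2 (ys @ [Suc (out w1 w2 ys)]))) / 2 - log 2 (\<Lambda> w1 w2 ys))"
    using M1_pos by (intro final_exp_increments) (simp add: \<Lambda>_def)
  also have "avg (\<lambda>w1 w2 ys.
    (log 2 (\<Lambda> w1 w2 (ys @ [out w1 w2 ys])) + log 2 (\<Lambda> w1 w2 (ys @ [Suc (out w1 w2 ys)]))) / 2 - log 2 (\<Lambda> w1 w2 ys))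
    = avg (\<lambda>w1 w2 ys. if a w1 ys then log 2 (post1 w1 ys) else log 2 (1 - post1 w1 ys))"
  proof (rule avg_cong)
    fix w1 w2 ys assume w1: "w1 \<in> {1..M1}"
    let ?p = "if a w1 ys then post1 w1 ys else 1 - post1 w1 ys"
    have L: "\<Lambda> w1 w2 (ys @ [y]) = \<Lambda> w1 w2 ys * ?p" for y
      unfolding \<Lambda>_def card_msg_class_snoc[OF w1] by simp
    hence "?p > 0" using \<Lambda>_pos[OF w1, of w2 ys] \<Lambda>_pos[OF w1, of w2 "ys @ [0]"]
      by (metis zero_less_mult_pos)
    hence "log 2 (\<Lambda> w1 w2 (ys @ [y])) = log 2 (\<Lambda> w1 w2 ys) + log 2 ?p" for y
      unfolding L using \<Lambda>_pos[OF w1] by (intro log_mult_pos) auto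
    thus "(log 2 (\<Lambda> w1 w2 (ys @ [out w1 w2 ys])) + log 2 (\<Lambda> w1 w2 (ys @ [Suc (out w1 w2 ys)]))) / 2 - log 2 (\<Lambda> w1 w2 ys)
      = (if a w1 ys then log 2 (post1 w1 ys) else log 2 (1 - post1 w1 ys))"
      by (simp add: add_divide_distrib)
  qed
  also have "\<dots> = avg (\<lambda>w1 w2 ys. post1 w1 ys * log 2 (post1 w1 ys) + (1 - post1 w1 ys) * log 2 (1 - post1 w1 ys))"
    by (rule avg_input1) (simp_all add: post1_cong)
  also have "\<dots> = avg (\<lambda>w1 w2 ys. (-1) * bin_entropy (post1 w1 ys))"
    by (rule avg_cong) (simp add: bin_entropy_def)
  finally show ?thesis unfolding avg_cmult by simp
qed

section \<open>Variances and the constraint set\<close>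

definition var1 :: real where
  "var1 = avg (\<lambda>w1 w2 ys. post1 w1 ys * (1 - post1 w1 ys))"

definition var2 :: real where
  "var2 = avg (\<lambda>w1 w2 ys. post2 w1 ys * (1 - post2 w1 ys))"

lemma avg_jensen:
  assumes "concave_on S f" and "\<And>w1 w2 ys. G w1 w2 ys \<in> S"
  shows "avg (\<lambda>w1 w2 ys. f (G w1 w2 ys)) \<le> f (avg G)"
proof -
  define Z where "Z = {1..M1} \<times> {1..M2} \<times> short_words n"
  define wt where "wt = (\<lambda>(w1, w2, ys). lik w1 w2 ys / (M1 * M2 * n))"
  have avg: "avg F = (\<Sum>z\<in>Z. wt z * (case z of (w1, w2, ys) \<Rightarrow> F w1 w2 ys))" for F
    unfolding avg_def Z_def wt_def
    by (simp add: sum.cartesian_product sum_divide_distrib case_prod_unfold)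
  have "[] \<in> short_words n" using n_pos by (simp add: short_words_def)
  hence Z: "finite Z" "Z \<noteq> {}" using M1_pos M2_pos by (auto simp: Z_def)
  have "(\<Sum>z\<in>Z. wt z) = 1" using avg_1 unfolding avg by (simp add: case_prod_unfold)
  hence "(\<Sum>z\<in>Z. wt z * f (case z of (w1, w2, ys) \<Rightarrow> G w1 w2 ys)) \<le>
      f (\<Sum>z\<in>Z. wt z *\<^sub>R (case z of (w1, w2, ys) \<Rightarrow> G w1 w2 ys))"
    using assms Z by (intro concave_on_sum) (auto simp: wt_def split: prod.splits)
  thus ?thesis unfolding avg by (simp add: case_prod_unfold)
qed

lemma avg_entropy_post1_le: "avg (\<lambda>w1 w2 ys. bin_entropy (post1 w1 ys)) \<le> bin_entropy (phi (2 * var1))"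
  using avg_jensen[OF concave_on_entropy_phi, of "\<lambda>w1 w2 ys. post1 w1 ys * (1 - post1 w1 ys)"]
    variance_range[OF post1_range] by (simp only: var1_def bin_entropy_phi_var[OF post1_range])

lemma avg_entropy_post2_le: "avg (\<lambda>w1 w2 ys. bin_entropy (post2 w1 ys)) \<le> bin_entropy (phi (2 * var2))"
  using avg_jensen[OF concave_on_entropy_phi, of "\<lambda>w1 w2 ys. post2 w1 ys * (1 - post2 w1 ys)"]
    variance_range[OF post2_range] by (simp only: var2_def bin_entropy_phi_var[OF post2_range])

text \<open>Inputs are read as signs. User 2 is averaged out first; since \<open>post2\<close> is
  constant on the classes of user 1, the first input can then be replaced by
  \<open>post1\<close>.\<close>

lemma avg_correlation:
  "avg (\<lambda>w1 w2 ys. (1 - 2 * post1 w1 ys) * (1 - 2 * post2 w1 ys)) = 1 - 2 * mismatch"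
proof -
  have "1 - 2 * mismatch = avg (\<lambda>w1 w2 ys. 1 - 2 * of_bool (a w1 ys \<noteq> b w2 ys))"
    unfolding avg_diff avg_1 avg_cmult mismatch_def ..
  also have "\<dots> = avg (\<lambda>w1 w2 ys. if b w2 ys then (if a w1 ys then 1 else - 1) else (if a w1 ys then - 1 else 1))"
    by (rule avg_cong) auto
  also have "\<dots> = avg (\<lambda>w1 w2 ys. if a w1 ys then - (1 - 2 * post2 w1 ys) else 1 - 2 * post2 w1 ys)"
    unfolding avg_input2 by (rule avg_cong) auto
  also have "\<dots> = avg (\<lambda>w1 w2 ys. (1 - 2 * post1 w1 ys) * (1 - 2 * post2 w1 ys))"
    by (subst avg_input1) (auto simp: post2_cong algebra_simps)
  finally show ?thesis ..
qed

lemma avg_cauchy_schwarz: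
  "(avg (\<lambda>w1 w2 ys. F w1 w2 ys * G w1 w2 ys))\<^sup>2 \<le> avg (\<lambda>w1 w2 ys. (F w1 w2 ys)\<^sup>2) * avg (\<lambda>w1 w2 ys. (G w1 w2 ys)\<^sup>2)"
proof -
  define A B C where "A = avg (\<lambda>w1 w2 ys. (F w1 w2 ys)\<^sup>2)"
    and "B = avg (\<lambda>w1 w2 ys. (G w1 w2 ys)\<^sup>2)" and "C = avg (\<lambda>w1 w2 ys. F w1 w2 ys * G w1 w2 ys)"
  have quad: "0 \<le> A + (2 * t) * C + t\<^sup>2 * B" for t
  proof -
    have "0 \<le> avg (\<lambda>w1 w2 ys. (F w1 w2 ys + t * G w1 w2 ys)\<^sup>2)"
      using avg_mono[of "\<lambda>_ _ _. 0" "\<lambda>w1 w2 ys. (F w1 w2 ys + t * G w1 w2 ys)\<^sup>2"] by (simp add: avg_const)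
    also have "\<dots> = avg (\<lambda>w1 w2 ys. (F w1 w2 ys)\<^sup>2 + (2 * t) * (F w1 w2 ys * G w1 w2 ys) + t\<^sup>2 * (G w1 w2 ys)\<^sup>2)"
      by (rule avg_cong) (simp add: power2_eq_square algebra_simps)
    also have "\<dots> = A + (2 * t) * C + t\<^sup>2 * B"
      unfolding A_def B_def C_def avg_add avg_cmult ..
    finally show ?thesis .
  qed
  have "B \<ge> 0" using avg_mono[of "\<lambda>_ _ _. 0" "\<lambda>w1 w2 ys. (G w1 w2 ys)\<^sup>2"] by (simp add: avg_const B_def)
  have "C\<^sup>2 \<le> A * B"
  proof (cases "B = 0")
    case True
    have "C = 0"
    proof (rule ccontr)
      assume "C \<noteq> 0"
      \<comment> \<open>For \<open>B = 0\<close> the quadratic is linear in \<open>t\<close>, and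
        this \<open>t\<close> gives it the value -1.\<close>
      thus False using quad[of "- (A + 1) / (2 * C)"] True by (simp add: field_simps)
    qed
    thus ?thesis using True by simp
  next
    case False
    hence "B > 0" using \<open>B \<ge> 0\<close> by simp
    \<comment> \<open>The quadratic at its minimiser \<open>t = - C / B\<close>.\<close>
    have "A + 2 * (- C / B) * C + (- C / B)\<^sup>2 * B = (A * B - C\<^sup>2) / B"
      using \<open>B > 0\<close> by (simp add: field_simps power2_eq_square)
    thus ?thesis using quad[of "- C / B"] \<open>B > 0\<close> by (simp add: zero_le_divide_iff)
  qed
  thus ?thesis by (simp add: A_def B_def C_def)
qed

lemma avg_square_post:
  "avg (\<lambda>w1 w2 ys. (1 - 2 * post1 w1 ys)\<^sup>2) = 1 - 4 * var1"
  "avg (\<lambda>w1 w2 ys. (1 - 2 * post2 w1 ys)\<^sup>2) = 1 - 4 * var2"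
proof -
  have sq: "(1 - 2 * p)\<^sup>2 = 1 - 4 * (p * (1 - p))" for p :: real
    by (simp add: power2_eq_square algebra_simps)
  show "avg (\<lambda>w1 w2 ys. (1 - 2 * post1 w1 ys)\<^sup>2) = 1 - 4 * var1"
    "avg (\<lambda>w1 w2 ys. (1 - 2 * post2 w1 ys)\<^sup>2) = 1 - 4 * var2"
    unfolding sq avg_diff avg_cmult avg_1 var1_def var2_def by simp_all
qed

lemma var_range: "var1 \<in> {0..1/4}" "var2 \<in> {0..1/4}"
proof -
  have avg_range: "avg G \<in> {0..1/4}" if "\<And>w1 w2 ys. G w1 w2 ys \<in> {0..1/4}" for G
    using that avg_mono[of "\<lambda>_ _ _. 0" G] avg_mono[of G "\<lambda>_ _ _. 1/4"] by (simp add: avg_const)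
  show "var1 \<in> {0..1/4}" "var2 \<in> {0..1/4}"
    unfolding var1_def var2_def
    by (intro avg_range variance_range post1_range post2_range)+
qed

lemma var_mismatch_in_P_set: "(var1, var2, mismatch) \<in> P_set"
proof -
  let ?x = "\<lambda>w1 ys. 1 - 2 * post1 w1 ys" and ?y = "\<lambda>w1 ys. 1 - 2 * post2 w1 ys"
  have "(1 - 2 * mismatch)\<^sup>2 \<le> (1 - 4 * var1) * (1 - 4 * var2)"
    using avg_cauchy_schwarz[of "\<lambda>w1 w2 ys. ?x w1 ys" "\<lambda>w1 w2 ys. ?y w1 ys"]
    unfolding avg_correlation avg_square_post .
  hence "1 - 2 * mismatch \<le> sqrt ((1 - 4 * var1) * (1 - 4 * var2))"
    by (rule real_le_rsqrt)
  hence f: "f_fun (2 * var1) (2 * var2) \<le> mismatch"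
    using var_range by (simp add: f_fun_eq)
  have "(- 1 / 2) * (x\<^sup>2 + y\<^sup>2) \<le> x * y" for x y :: real
    using zero_le_power2[of "x + y"] by (simp add: power2_sum field_simps)
  hence "avg (\<lambda>w1 w2 ys. (- 1 / 2) * ((?x w1 ys)\<^sup>2 + (?y w1 ys)\<^sup>2)) \<le> avg (\<lambda>w1 w2 ys. ?x w1 ys * ?y w1 ys)"
    by (intro avg_mono)
  hence "(- 1 / 2) * (1 - 4 * var1 + (1 - 4 * var2)) \<le> 1 - 2 * mismatch"
    unfolding avg_cmult avg_add avg_correlation avg_square_post .
  hence "mismatch \<le> 1 - (var1 + var2)" by (simp add: field_simps)
  thus ?thesis using f var_range by (simp add: P_set_def)
qed

theorem rates_in_D1:
  "((success g * log 2 M1 - 1) / n, (success g * log 2 M2 - 1) / n) \<in> D1"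
proof -
  have n: "0 < real n" using n_pos by simp
  have le: "x / n \<le> y" if "x \<le> n * z" "z \<le> y" for x y z :: real
  proof -
    have "x \<le> n * y" using that n by (meson mult_left_mono of_nat_0_le_iff order_trans)
    thus ?thesis using n by (simp add: pos_divide_le_eq mult.commute)
  qed
  \<comment> \<open>The two rates together carry the penalty 1 twice, the sum bound only once; one
    of them is given away.\<close>
  have "(success g * log 2 M1 - 1) / n + (success g * log 2 M2 - 1) / n =
      (success g * log 2 (real M1 * real M2) - 1 - 1) / n"
    using M1_pos M2_pos by (simp add: log_mult_pos add_divide_distrib[symmetric] distrib_left)
  also have "\<dots> \<le> (success g * log 2 (real M1 * real M2) - 1) / n"
    by (intro divide_right_mono) auto
  also have "\<dots> \<le> bin_entropy ((1 - mismatch) / 2)"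
    by (rule le[OF success_le_sum_entropy order_refl])
  finally show ?thesis
    unfolding D1_def
    using var_mismatch_in_P_set le[OF success_le_half_mismatch_entropy order_refl]
      le[OF success_le_entropy_post1 avg_entropy_post1_le]
      le[OF success_le_half_entropy_post2, of "1/2 * bin_entropy (phi (2 * var2))"] avg_entropy_post2_le
    by (intro UN_I[of "(var1, var2, mismatch)"]) auto
qed

end

section \<open>The outer regions\<close>

lemma D1_downward_closed: "(x, y) \<in> D1 \<Longrightarrow> x' \<le> x \<Longrightarrow> y' \<le> y \<Longrightarrow> (x', y') \<in> D1"
  unfolding D1_def by fastforce

text \<open>\<open>f_fun\<close> is symmetric, so \<open>P_set\<close> is invariant under exchange
  of \<open>u1\<close> and \<open>u2\<close>. Facts on \<open>D2\<close> are then inherited from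
  \<open>D1\<close>.\<close>

lemma D2_eq_swap_D1: "D2 = prod.swap -` D1"
proof -
  have "(u2, u1, u) \<in> P_set" if "(u1, u2, u) \<in> P_set" for u1 u2 u
    using that by (simp add: P_set_def f_fun_def algebra_simps)
  thus ?thesis
    unfolding D1_def D2_def by (fastforce simp: add.commute)
qed

lemma D2_downward_closed: "(x, y) \<in> D2 \<Longrightarrow> x' \<le> x \<Longrightarrow> y' \<le> y \<Longrightarrow> (x', y') \<in> D2"
  unfolding D2_eq_swap_D1 vimage_def by (simp, rule D1_downward_closed)

lemma P_set_subset: "P_set \<subseteq> {0..1/4} \<times> {0..1/4} \<times> {0..1}"
proof
  fix z assume "z \<in> P_set"
  then obtain u1 u2 u where z: "z = (u1, u2, u)" and u: "0 \<le> u1" "u1 \<le> 1/4" "0 \<le> u2" "u2 \<le> 1/4"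
      "f_fun (2 * u1) (2 * u2) \<le> u" "u \<le> 1 - (u1 + u2)"
    by (auto simp: P_set_def)
  have "sqrt ((1 - 2 * (2 * u1)) * (1 - 2 * (2 * u2))) \<le> 1"
    using u mult_le_one[of "1 - 2 * (2 * u1)" "1 - 2 * (2 * u2)"] by simp
  hence "0 \<le> f_fun (2 * u1) (2 * u2)" using u by (subst f_fun_eq) auto
  thus "z \<in> {0..1/4} \<times> {0..1/4} \<times> {0..1}" using u by (simp add: z)
qed

lemma compact_P_set: "compact P_set"
proof -
  let ?B = "{0..1/4} \<times> {0..1/4} \<times> {0..1::real}"
  let ?f = "\<lambda>z::real \<times> real \<times> real. f_fun (2 * fst z) (2 * fst (snd z))"
  have "continuous_on ?B (\<lambda>z. phi (2 * fst z))" "continuous_on ?B (\<lambda>z. phi (2 * fst (snd z)))"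
    by (rule continuous_on_compose2[OF continuous_on_phi_double]; auto intro!: continuous_intros)+
  hence f: "continuous_on ?B ?f"
    unfolding f_fun_def by (intro continuous_intros)
  have "closed ({z \<in> ?B. ?f z \<le> snd (snd z)} \<inter> {z \<in> ?B. snd (snd z) \<le> 1 - (fst z + fst (snd z))})"
    by (intro closed_Int continuous_on_closed_Collect_le f continuous_intros closed_Times)
  also have "\<dots> = P_set"
    using P_set_subset by (auto simp: P_set_def)
  finally have "closed (?B \<inter> P_set)" using P_set_subset by (simp add: Int_absorb1)
  hence "compact (?B \<inter> (?B \<inter> P_set))" by (intro compact_Int_closed compact_Times compact_Icc)
  thus ?thesis using P_set_subset by (simp add: Int_absorb1)
qed

text \<open>\<open>D1\<close> is the projection of a closed set along the compact factor
  \<open>P_set\<close>, on which the entropy bounds are continuous.\<close>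

lemma closed_D1: "closed D1"
proof -
  let ?S = "P_set \<times> (UNIV :: (real \<times> real) set)"
  let ?u1 = "\<lambda>z::(real \<times> real \<times> real) \<times> real \<times> real. fst (fst z)"
  let ?u2 = "\<lambda>z::(real \<times> real \<times> real) \<times> real \<times> real. fst (snd (fst z))"
  let ?u = "\<lambda>z::(real \<times> real \<times> real) \<times> real \<times> real. snd (snd (fst z))"
  have S: "closed ?S" by (intro closed_Times compact_imp_closed compact_P_set closed_UNIV)
  have range: "?u1 z \<in> {0..1/4}" "?u2 z \<in> {0..1/4}" "?u z \<in> {0..1}" if "z \<in> ?S" for z
  proof -
    have "fst z \<in> {0..1/4} \<times> {0..1/4} \<times> {0..1}" using that P_set_subset by auto
    thus "?u1 z \<in> {0..1/4}" "?u2 z \<in> {0..1/4}" "?u z \<in> {0..1}"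
      unfolding mem_Times_iff by simp_all
  qed
  have cont: "continuous_on ?S (\<lambda>z. bin_entropy (phi (2 * ?u1 z)))" "continuous_on ?S (\<lambda>z. bin_entropy (phi (2 * ?u2 z)))"
    "continuous_on ?S (\<lambda>z. bin_entropy (?u z))" "continuous_on ?S (\<lambda>z. bin_entropy ((1 - ?u z) / 2))"
    using range
    by (intro continuous_on_compose2[OF continuous_on_entropy_phi] continuous_on_compose2[OF continuous_on_bin_entropy]
        continuous_intros image_subsetI; force)+
  define T where "T = {z \<in> ?S. fst (snd z) \<le> min (1/2 * bin_entropy (?u z)) (bin_entropy (phi (2 * ?u1 z)))} \<inter>
    ({z \<in> ?S. snd (snd z) \<le> 1/2 * bin_entropy (phi (2 * ?u2 z))} \<inter>
     {z \<in> ?S. fst (snd z) + snd (snd z) \<le> bin_entropy ((1 - ?u z) / 2)})"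
  have "closed T"
    unfolding T_def
    by (intro closed_Int continuous_on_closed_Collect_le S cont continuous_intros)
  hence "closed {R. \<exists>p. p \<in> P_set \<and> (p, R) \<in> T}"
    by (rule closed_compact_projection[OF compact_P_set])
  also have "{R. \<exists>p. p \<in> P_set \<and> (p, R) \<in> T} = D1"
    by (force simp: T_def D1_def)
  finally show ?thesis .
qed

lemma closed_D2: "closed D2"
  unfolding D2_eq_swap_D1
  by (rule continuous_closed_vimage[OF closed_D1])
     (auto simp: prod.swap_def intro!: continuous_intros)


section \<open>Feedback codes\<close>

lemma pmf_bind_map_inj:
  assumes inj: "\<And>x y x' y'. h x y = h x' y' \<Longrightarrow> x = x' \<and> y = y'"
  shows "pmf (bind_pmf P (\<lambda>x. map_pmf (h x) (Q x))) (h x y) = pmf P x * pmf (Q x) y"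
proof -
  have "pmf (map_pmf (h x') (Q x')) (h x y) = indicator {x} x' * pmf (Q x) y" for x'
  proof (cases "x' = x")
    case True
    have "inj (h x)" by (rule injI) (use inj in blast)
    thus ?thesis using True by (simp add: pmf_map_inj')
  next
    case False
    hence "h x y \<notin> set_pmf (map_pmf (h x') (Q x'))" using inj by (simp only: set_map_pmf image_iff) blast
    thus ?thesis using False by (simp add: set_pmf_eq)
  qed
  thus ?thesis by (simp add: pmf_bind measure_pmf_single)
qed

lemma pmf_law_binary_additive_mac:
  assumes "x1 \<in> {0, 1}" "x2 \<in> {0, 1}"
  shows "pmf (law binary_additive_mac x1 x2) y = chan (x1 = 1) (x2 = 1) y"
proof -
  have "law binary_additive_mac x1 x2 = pmf_of_set {x1 + x2, Suc (x1 + x2)}"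
    by (simp add: binary_additive_mac_def map_pmf_of_set_inj inj_on_def)
  thus ?thesis using assms by (auto simp: chan_def pmf_of_set indicator_def)
qed

text \<open>Codes count time from 1, so the input sent after a history of length i - 1 has number
  i.\<close>

definition input_is_1 :: "(nat \<Rightarrow> nat \<Rightarrow> nat list \<Rightarrow> nat) \<Rightarrow> nat \<Rightarrow> nat list \<Rightarrow> bool" where
  "input_is_1 e w ys \<longleftrightarrow> e (Suc (length ys)) w ys = 1"

locale binary_additive_code =
  fixes n M1 M2 :: nat and c :: "(nat, nat, nat) fb_code"
  assumes code: "is_fb_code binary_additive_mac n M1 M2 c" and block_pos: "1 \<le> n"

sublocale binary_additive_code \<subseteq>
  two_user_code M1 M2 n "input_is_1 (enc1 c)" "input_is_1 (enc2 c)"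
  using code block_pos by unfold_locales (auto simp: is_fb_code_def)

context binary_additive_code
begin

text \<open>A code promises binary inputs only at times up to \<open>n\<close> and after words over
  the output alphabet, hence \<open>k \<le> n\<close> and the restriction to
  \<open>words k\<close>.\<close>

lemma pmf_output:
  assumes "w1 \<in> {1..M1}" "w2 \<in> {1..M2}"
  shows "k \<le> n \<Longrightarrow> ys \<in> words k \<Longrightarrow> pmf (output_pmf binary_additive_mac c w1 w2 k) ys = lik w1 w2 ys"
proof (induction k arbitrary: ys)
  case (Suc k)
  from Suc.prems(2) obtain zs y where ys: "ys = zs @ [y]" and zs: "zs \<in> words k"
    by (cases ys rule: rev_cases) (auto simp: words_def)
  have len: "length zs = k" and set: "set zs \<subseteq> outp binary_additive_mac"
    using zs by (auto simp: words_def binary_additive_mac_def)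
  have "Suc k \<in> {1..n}" using Suc.prems(1) by simp
  moreover have "length zs = Suc k - 1" using len by simp
  ultimately have "enc1 c (Suc k) w1 zs \<in> inp1 binary_additive_mac" "enc2 c (Suc k) w2 zs \<in> inp2 binary_additive_mac"
    using code assms set unfolding is_fb_code_def by blast+
  hence enc: "enc1 c (Suc k) w1 zs \<in> {0, 1}" "enc2 c (Suc k) w2 zs \<in> {0, 1}"
    by (simp_all add: binary_additive_mac_def)
  have "pmf (output_pmf binary_additive_mac c w1 w2 (Suc k)) ys = pmf (output_pmf binary_additive_mac c w1 w2 k) zs *
     pmf (law binary_additive_mac (enc1 c (Suc k) w1 zs) (enc2 c (Suc k) w2 zs)) y"
    unfolding ys output_pmf.simps by (rule pmf_bind_map_inj) simp
  also have "pmf (output_pmf binary_additive_mac c w1 w2 k) zs = lik w1 w2 zs"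
    using Suc.IH[OF _ zs] Suc.prems(1) by simp
  also have "lik w1 w2 zs * pmf (law binary_additive_mac (enc1 c (Suc k) w1 zs) (enc2 c (Suc k) w2 zs)) y = lik w1 w2 ys"
    by (simp only: ys lik_snoc input_is_1_def len pmf_law_binary_additive_mac[OF enc])
  finally show ?case .
qed simp

lemma pmf_joint:
  assumes "w1 \<in> {1..M1}" "w2 \<in> {1..M2}" "ys \<in> words n"
  shows "pmf (joint_pmf binary_additive_mac n M1 M2 c) ((w1, w2), ys) = lik w1 w2 ys / (M1 * M2)"
proof -
  have "joint_pmf binary_additive_mac n M1 M2 c =
      bind_pmf (pair_pmf (pmf_of_set {1..M1}) (pmf_of_set {1..M2}))
        (\<lambda>w. map_pmf (Pair w) (output_pmf binary_additive_mac c (fst w) (snd w) n))"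
    by (simp add: joint_pmf_def case_prod_unfold)
  hence "pmf (joint_pmf binary_additive_mac n M1 M2 c) ((w1, w2), ys) =
      pmf (pair_pmf (pmf_of_set {1..M1}) (pmf_of_set {1..M2})) (w1, w2) *
      pmf (output_pmf binary_additive_mac c (fst (w1, w2)) (snd (w1, w2)) n) ys"
    by (simp only:) (rule pmf_bind_map_inj, simp)
  thus ?thesis using assms by (simp add: pmf_pair pmf_output)
qed

lemma prob_joint_words:
  "measure_pmf.prob (joint_pmf binary_additive_mac n M1 M2 c) (A \<inter> ({1..M1} \<times> {1..M2}) \<times> words n) =
    final_exp (\<lambda>w1 w2 ys. of_bool (((w1, w2), ys) \<in> A))"
proof -
  let ?Z = "({1..M1} \<times> {1..M2}) \<times> words n"
  have "measure_pmf.prob (joint_pmf binary_additive_mac n M1 M2 c) (A \<inter> ?Z) =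
      (\<Sum>z\<in>A \<inter> ?Z. pmf (joint_pmf binary_additive_mac n M1 M2 c) z)"
    by (rule measure_measure_pmf_finite) auto
  also have "\<dots> = (\<Sum>z\<in>?Z. pmf (joint_pmf binary_additive_mac n M1 M2 c) z * of_bool (z \<in> A))"
    by (rule sum.mono_neutral_cong_left) (simp_all add: of_bool_def, blast)
  also have "\<dots> = (\<Sum>z\<in>?Z. lik (fst (fst z)) (snd (fst z)) (snd z) / (M1 * M2) * of_bool (z \<in> A))"
    by (intro sum.cong refl) (auto simp: pmf_joint)
  also have "\<dots> = final_exp (\<lambda>w1 w2 ys. of_bool (((w1, w2), ys) \<in> A))"
    unfolding final_exp_def sum_divide_distrib sum_nested_product
    by (intro sum.cong refl) simp
  finally show ?thesis .
qed

lemma success_dec: "success (dec c) = 1 - error_prob binary_additive_mac n M1 M2 c"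
proof -
  let ?J = "joint_pmf binary_additive_mac n M1 M2 c"
  let ?Z = "({1..M1} \<times> {1..M2}) \<times> words n"
  let ?E = "{(w, ys). dec c ys \<noteq> w}"
  \<comment> \<open>Admissible messages and words carry the full mass, so the event of correct
    decoding can be cut down to \<open>?Z\<close>.\<close>
  have "measure_pmf.prob ?J ?Z = 1"
    using prob_joint_words[of UNIV] by (simp add: final_exp_1)
  hence "AE z in ?J. z \<in> ?Z"
    by (simp only: measure_pmf.AE_in_set_eq_1 sets_measure_pmf UNIV_I)
  hence Z: "set_pmf ?J \<subseteq> ?Z"
    unfolding AE_measure_pmf_iff by blast
  have "error_prob binary_additive_mac n M1 M2 c = 1 - measure_pmf.prob ?J (- ?E)"
    unfolding error_prob_def using measure_pmf.prob_compl[of ?E ?J] by (simp add: Compl_eq_Diff_UNIV)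
  also have "measure_pmf.prob ?J (- ?E) = measure_pmf.prob ?J (- ?E \<inter> set_pmf ?J)"
    by (simp only: measure_Int_set_pmf)
  also have "- ?E \<inter> set_pmf ?J = (- ?E \<inter> ?Z) \<inter> set_pmf ?J"
    using Z by blast
  also have "measure_pmf.prob ?J \<dots> = measure_pmf.prob ?J (- ?E \<inter> ?Z)"
    by (simp only: measure_Int_set_pmf)
  also have "\<dots> = success (dec c)"
    unfolding prob_joint_words success_def by simp
  finally show ?thesis by simp
qed

lemma code_rates_in_D1:
  "(((1 - error_prob binary_additive_mac n M1 M2 c) * log 2 M1 - 1) / n,
    ((1 - error_prob binary_additive_mac n M1 M2 c) * log 2 M2 - 1) / n) \<in> D1"
  using rates_in_D1[of "dec c"] unfolding success_dec .

text \<open>The channel is symmetric in its inputs, so exchanging the users and swapping the decoder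
  output preserves the success probability.\<close>

lemma code_rates_in_D2:
  "(((1 - error_prob binary_additive_mac n M1 M2 c) * log 2 M1 - 1) / n,
    ((1 - error_prob binary_additive_mac n M1 M2 c) * log 2 M2 - 1) / n) \<in> D2"
proof -
  interpret sw: two_user_code M2 M1 n "input_is_1 (enc2 c)" "input_is_1 (enc1 c)"
    by unfold_locales (use M1_pos M2_pos n_pos in auto)
  have lik: "sw.lik w2 w1 = lik w1 w2" for w1 w2
    unfolding lik_def sw.lik_def by (simp only: chan_commute)
  have "sw.success (prod.swap \<circ> dec c) = success (dec c)"
    unfolding success_def sw.success_def final_exp_def sw.final_exp_def lik
    by (subst sum.swap) (simp add: mult.commute prod_eq_iff conj_commute)
  thus ?thesis
    using sw.rates_in_D1[of "prod.swap \<circ> dec c"] by (simp add: D2_eq_swap_D1 success_dec)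
qed

end

section \<open>From codes to the capacity region\<close>

text \<open>Codes put points of \<open>D\<close> within reach of \<open>R\<close> up to the error
  factor and the loss \<open>1 / n\<close>. Both losses tend to 0, and closedness keeps the limit in
  \<open>D\<close>.\<close>

lemma achievable_in_outer_region:
  assumes ach: "achievable C R" and "closed D"
    and down: "\<And>x y x' y'. (x, y) \<in> D \<Longrightarrow> x' \<le> x \<Longrightarrow> y' \<le> y \<Longrightarrow> (x', y') \<in> D"
    and codes: "\<And>n M1 M2 c. is_fb_code C n M1 M2 c \<Longrightarrow> 1 \<le> n \<Longrightarrow>
      (((1 - error_prob C n M1 M2 c) * log 2 M1 - 1) / n, ((1 - error_prob C n M1 M2 c) * log 2 M2 - 1) / n) \<in> D"
  shows "R \<in> D"
proof -
  obtain R1 R2 where R: "R = (R1, R2)" by fastforce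
  have R0: "0 \<le> R1" "0 \<le> R2" using ach by (auto simp: achievable_def R)
  define e where "e = (\<lambda>m. 1 / real (Suc m))"
  have mem: "((1 - e m) * R1 - e m, (1 - e m) * R2 - e m) \<in> D" for m
  proof -
    have e: "0 < e m" "e m \<le> 1" by (auto simp: e_def)
    have "\<forall>\<^sub>F n in sequentially. \<exists>M1 M2 c. is_fb_code C n M1 M2 c
        \<and> R1 \<le> log 2 (real M1) / real n \<and> R2 \<le> log 2 (real M2) / real n \<and> error_prob C n M1 M2 c \<le> e m"
      using ach e unfolding achievable_def R by simp
    \<comment> \<open>Block lengths of at least \<open>Suc m\<close> give
      \<open>1 / n \<le> e m\<close>, so one parameter controls both losses.\<close>
    hence "\<forall>\<^sub>F n in sequentially. Suc m \<le> n \<and> (\<exists>M1 M2 c. is_fb_code C n M1 M2 c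
        \<and> R1 \<le> log 2 (real M1) / real n \<and> R2 \<le> log 2 (real M2) / real n \<and> error_prob C n M1 M2 c \<le> e m)"
      by (intro eventually_conj eventually_ge_at_top)
    then obtain n M1 M2 c where n: "Suc m \<le> n" and c: "is_fb_code C n M1 M2 c"
      and rates: "R1 \<le> log 2 (real M1) / real n" "R2 \<le> log 2 (real M2) / real n"
      and err: "error_prob C n M1 M2 c \<le> e m"
      using eventually_happens'[OF sequentially_bot] by blast
    have "(1 - e m) * r - e m \<le> ((1 - error_prob C n M1 M2 c) * L - 1) / n"
      if "0 \<le> r" "r \<le> L / n" for r L
    proof -
      have "(1 - e m) * r \<le> (1 - error_prob C n M1 M2 c) * (L / n)"
        using that e err by (intro mult_mono) auto
      moreover have "1 / real n \<le> e m" unfolding e_def using n by (intro divide_left_mono) auto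
      ultimately show ?thesis by (simp add: diff_divide_distrib)
    qed
    thus ?thesis using down[OF codes[OF c]] n rates R0 by simp
  qed
  have "(\<lambda>m. ((1 - e m) * R1 - e m, (1 - e m) * R2 - e m)) \<longlonglongrightarrow> ((1 - 0) * R1 - 0, (1 - 0) * R2 - 0)"
    unfolding e_def by (intro tendsto_intros LIMSEQ_Suc[OF lim_inverse_n', unfolded inverse_eq_divide])
  hence "((1 - 0) * R1 - 0, (1 - 0) * R2 - 0) \<in> D"
    by (rule closed_sequentially[OF \<open>closed D\<close>, rotated]) (rule mem)
  thus ?thesis by (simp add: R)
qed

theorem mainTheorem2:
  shows "capacity_region binary_additive_mac \<subseteq> D1 \<inter> D2"
proof -
  have code: "binary_additive_code n M1 M2 c" if "is_fb_code binary_additive_mac n M1 M2 c" "1 \<le> n" for n M1 M2 c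
    using that by unfold_locales
  have "{R. achievable binary_additive_mac R} \<subseteq> D1 \<inter> D2"
  proof safe
    fix x y assume ach: "achievable binary_additive_mac (x, y)"
    show "(x, y) \<in> D1"
      using D1_downward_closed binary_additive_code.code_rates_in_D1[OF code]
      by (rule achievable_in_outer_region[OF ach closed_D1])
    show "(x, y) \<in> D2"
      using D2_downward_closed binary_additive_code.code_rates_in_D2[OF code]
      by (rule achievable_in_outer_region[OF ach closed_D2])
  qed
  thus ?thesis
    unfolding capacity_region_def by (intro closure_minimal closed_Int closed_D1 closed_D2)
qed

end
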